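(* Let $(X,Z)$ be a pair of Banach spaces with property ( * ). Let $Y$ be a closed subspace of $X$ such that the pair $(Y,Z)$ has the linear $X$-extension property. Then every $C^1$ smooth mapping $f:Y\to Z$ has a $C^1$ smooth extension to $X$. Moreover, there is $C\ge1$, which depends on $X$, $Y$ and $Z$, such that every Lipschitz and $C^1$ smooth mapping $f:Y\to Z$ has a Lipschitz and $C^1$ smooth extension $F:X\to Z$ to $X$ with $\operatorname{Lip}(F)\le C\operatorname{Lip}(f)$.
   Context: Banach spaces are real; $C^1$ smooth means continuously Fréchet differentiable. $\mathcal{L}(X,Z)$ is the space of bounded linear maps $X\to Z$ with the operator norm. For a mapping $f:A\to Z$ with $A\subset X$, $\operatorname{Lip}(f)=\sup\{\|f(x)-f(y)\|/\|x-y\| : x,y\in A,\ x\neq y\}$ (equal to $0$ if $A$ has at most one point). Property ( * ): the pair $(X,Z)$ has property ( * ) if there is a constant $C_0\ge 1$, depending only on $X$ and $Z$, such that for every subset $A\subset X$, every Lipschitz mapping $f:A\to Z$ and every $\varepsilon>0$, there is a $C^1$ smooth and Lipschitz mapping $g:X\to Z$ such that $\|f(x)-g(x)\|<\varepsilon$ for all $x\in A$ and $\operatorname{Lip}(g)\le C_0\operatorname{Lip}(f)$. Linear $X$-extension property: for $Y$ a closed subspace of $X$, the pair $(Y,Z)$ has the linear $X$-extension property if there is $\lambda\ge1$, depending on $X$, $Y$ and $Z$, such that for every bounded linear map $T:Y\to Z$ there is a bounded linear $\widetilde T:X\to Z$ with $\widetilde T|_Y=T$ and $\|\widetilde T\|_{\mathcal{L}(X,Z)}\le\lambda\|T\|_{\mathcal{L}(Y,Z)}$.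 *)

theory Defs
  imports "HOL-Analysis.Analysis"
begin

text \<open>
  A closed subspace \<open>Y\<close> of the Banach space \<open>'a\<close> is a set, and a mapping on \<open>Y\<close> is a total function
  of which only the values on \<open>Y\<close> are ever used. In particular a member of \<open>\<L>(Y, Z)\<close> is a function
  that is linear and bounded on \<open>Y\<close>; nothing is required of it outside \<open>Y\<close>.
\<close>

definition bounded_linear_on :: "'a::real_normed_vector set \<Rightarrow> ('a \<Rightarrow> 'b::real_normed_vector) \<Rightarrow> bool"
  where "bounded_linear_on Y T \<longleftrightarrow>
    (\<forall>x\<in>Y. \<forall>y\<in>Y. T (x + y) = T x + T y) \<and>
    (\<forall>c. \<forall>x\<in>Y. T (c *\<^sub>R x) = c *\<^sub>R T x) \<and>
    (\<exists>K. \<forall>x\<in>Y. norm (T x) \<le> norm x * K)"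

text \<open>As in the definition of \<open>onorm\<close>, the vector \<open>0\<close> contributes \<open>0 / 0 = 0\<close>.\<close>

definition onorm_on :: "'a::real_normed_vector set \<Rightarrow> ('a \<Rightarrow> 'b::real_normed_vector) \<Rightarrow> real"
  where "onorm_on Y T = (SUP x\<in>Y. norm (T x) / norm x)"

text \<open>
  Continuous Frechet differentiability on the normed space \<open>Y\<close>. The relation \<open>has_derivative\<close>
  with \<open>at x within Y\<close> is not used here, because it asks for a derivative that is bounded and linear
  on the whole of \<open>'a\<close>; the derivative here is only a member of \<open>\<L>(Y, Z)\<close>, and it depends
  continuously on the point in the operator norm of \<open>\<L>(Y, Z)\<close>.
\<close>

definition C1_smooth_on :: "'a::real_normed_vector set \<Rightarrow> ('a \<Rightarrow> 'b::real_normed_vector) \<Rightarrow> bool"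
  where "C1_smooth_on Y f \<longleftrightarrow>
    (\<exists>f'. \<forall>x\<in>Y.
       bounded_linear_on Y (f' x) \<and>
       ((\<lambda>y. norm (f y - f x - f' x (y - x)) / norm (y - x)) \<longlongrightarrow> 0) (at x within Y) \<and>
       ((\<lambda>y. onorm_on Y (\<lambda>v. f' y v - f' x v)) \<longlongrightarrow> 0) (at x within Y))"

definition C1_smooth :: "('a::real_normed_vector \<Rightarrow> 'b::real_normed_vector) \<Rightarrow> bool"
  where "C1_smooth f \<longleftrightarrow>
    (\<exists>f' :: 'a \<Rightarrow> 'a \<Rightarrow>\<^sub>L 'b.
       (\<forall>x. (f has_derivative blinfun_apply (f' x)) (at x)) \<and> continuous_on UNIV f')"

lemma bounded_linear_on_UNIV: "bounded_linear_on UNIV T \<longleftrightarrow> bounded_linear T"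
  by (auto simp: bounded_linear_on_def bounded_linear_def bounded_linear_axioms_def linear_iff)

lemma onorm_on_UNIV: "onorm_on UNIV T = onorm T"
  by (simp add: onorm_on_def onorm_def)

lemma C1_smooth_on_UNIV: "C1_smooth_on UNIV f \<longleftrightarrow> C1_smooth f"
proof
  assume "C1_smooth_on UNIV f"
  then obtain f' where f':
    "\<And>x. bounded_linear (f' x)"
    "\<And>x. ((\<lambda>y. norm (f y - f x - f' x (y - x)) / norm (y - x)) \<longlongrightarrow> 0) (at x)"
    "\<And>x. ((\<lambda>y. onorm (\<lambda>v. f' y v - f' x v)) \<longlongrightarrow> 0) (at x)"
    by (auto simp: C1_smooth_on_def bounded_linear_on_UNIV onorm_on_UNIV)
  define B where "B x = Blinfun (f' x)" for x
  have app: "blinfun_apply (B x) = f' x" for x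
    using f'(1) by (simp add: B_def bounded_linear_Blinfun_apply)
  have "(f has_derivative blinfun_apply (B x)) (at x)" for x
    using f'(1,2) by (simp add: has_derivative_iff_norm app)
  moreover have "continuous_on UNIV B"
    unfolding continuous_on_def
  proof
    fix x
    have "norm (B y - B x) = onorm (\<lambda>v. f' y v - f' x v)" for y
      by (simp add: norm_blinfun.rep_eq minus_blinfun.rep_eq app)
    then show "(B \<longlongrightarrow> B x) (at x)"
      using f'(3)[of x] by (simp add: tendsto_dist_iff[of B] dist_norm)
  qed
  ultimately show "C1_smooth f"
    unfolding C1_smooth_def by blast
next
  assume "C1_smooth f"
  then obtain B :: "'a \<Rightarrow> 'a \<Rightarrow>\<^sub>L 'b" where B:
    "\<And>x. (f has_derivative blinfun_apply (B x)) (at x)" "continuous_on UNIV B"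
    unfolding C1_smooth_def by blast
  have "((\<lambda>y. onorm (\<lambda>v. B y v - B x v)) \<longlongrightarrow> 0) (at x)" for x
  proof -
    have "(B \<longlongrightarrow> B x) (at x)"
      using B(2) by (simp add: continuous_on_def)
    moreover have "norm (B y - B x) = onorm (\<lambda>v. B y v - B x v)" for y
      by (simp add: norm_blinfun.rep_eq minus_blinfun.rep_eq)
    ultimately show ?thesis
      by (simp add: tendsto_dist_iff[of B] dist_norm)
  qed
  then show "C1_smooth_on UNIV f"
    using B(1) unfolding C1_smooth_on_def
    by (intro exI[of _ "\<lambda>x. blinfun_apply (B x)"])
      (auto simp: has_derivative_iff_norm bounded_linear_on_UNIV onorm_on_UNIV)
qed

definition Lipschitz_on :: "'a::real_normed_vector set \<Rightarrow> ('a \<Rightarrow> 'b::real_normed_vector) \<Rightarrow> bool"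
  where "Lipschitz_on A f \<longleftrightarrow> (\<exists>L. L-lipschitz_on A f)"

text \<open>
  Inserting \<open>0\<close> gives the value \<open>0\<close> when \<open>A\<close> has at most one point and changes nothing otherwise.
  As a real supremum, \<open>Lip A f\<close> is meaningful only if \<open>Lipschitz_on A f\<close> holds.
\<close>

definition Lip :: "'a::real_normed_vector set \<Rightarrow> ('a \<Rightarrow> 'b::real_normed_vector) \<Rightarrow> real"
  where "Lip A f =
    Sup (insert 0 {norm (f x - f y) / norm (x - y) | x y. x \<in> A \<and> y \<in> A \<and> x \<noteq> y})"

definition property_star :: "'a::banach itself \<Rightarrow> 'b::banach itself \<Rightarrow> bool"
  where "property_star X Z \<longleftrightarrow>
    (\<exists>C0::real. C0 \<ge> 1 \<and>
      (\<forall>(A::'a set) (f::'a \<Rightarrow> 'b) (e::real). Lipschitz_on A f \<and> e > 0 \<longrightarrow>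
        (\<exists>g::'a \<Rightarrow> 'b. C1_smooth g \<and> Lipschitz_on UNIV g \<and>
          (\<forall>x\<in>A. norm (f x - g x) < e) \<and> Lip UNIV g \<le> C0 * Lip A f)))"

definition linear_extension_property :: "'a::banach set \<Rightarrow> 'b::banach itself \<Rightarrow> bool"
  where "linear_extension_property Y Z \<longleftrightarrow>
    (\<exists>l::real. l \<ge> 1 \<and>
      (\<forall>T::'a \<Rightarrow> 'b. bounded_linear_on Y T \<longrightarrow>
        (\<exists>T'::'a \<Rightarrow>\<^sub>L 'b. (\<forall>y\<in>Y. blinfun_apply T' y = T y) \<and> norm T' \<le> l * onorm_on Y T)))"

end

theory Submission
  imports Defs
begin

text \<open>
  Write \<open>X\<close> for the ambient space and \<open>Z\<close> for the target. The Lipschitz extension is a series. If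
  \<open>f\<close> is \<open>C\<^sup>1\<close> smooth on \<open>Y\<close> with derivative bounded by \<open>L\<close>, then there is a \<open>C\<^sup>1\<close> smooth \<open>H\<close> on \<open>X\<close>
  whose derivative is bounded by \<open>K * L\<close> everywhere, with \<open>K\<close> independent of \<open>f\<close>, while the derivative
  of \<open>f - H\<close> along \<open>Y\<close> is bounded by \<open>L / 2\<close>. Applying this to \<open>f\<close>, then to \<open>f - H\<close>, and so on, gives
  maps whose derivatives are dominated by a geometric series; their sum is \<open>C\<^sup>1\<close> smooth, extends \<open>f\<close>
  and is \<open>2 * K * L\<close>-Lipschitz (\<open>lipschitz_C1_extension\<close>). Such an \<open>H\<close> has to be close to \<open>f\<close> in
  the \<open>C\<^sup>1\<close> sense on \<open>Y\<close> and to have a bounded derivative on all of \<open>X\<close>. The two requirements are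
  met one after the other.

  \<^item> Closeness on \<open>Y\<close> (\<open>C1_approximation_with_derivative\<close>). Near a point \<open>c\<close> of \<open>Y\<close>, subtract from \<open>f\<close>
    its first order Taylor map at \<open>c\<close>, with the derivative extended from \<open>Y\<close> to \<open>X\<close> by the linear
    extension property. The remainder has a small Lipschitz constant near \<open>c\<close>, so property (*)
    approximates it by a \<open>C\<^sup>1\<close> smooth map with a small derivative and an error on \<open>Y\<close> that is as small
    as desired. These local approximations are glued with a \<open>C\<^sup>1\<close> smooth partition of unity
    (\<open>glue_local_C1_maps\<close>). Differentiating the partition costs its slopes times the errors on \<open>Y\<close>, and
    the slopes are known before the errors are chosen. As \<open>X\<close> need not be separable, the partition
    comes from Stone's \<open>\<sigma>\<close>-discrete refinement of a covering by balls, for which slopes are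
    bounded level by level.

  \<^item> Boundedness on \<open>X\<close> (\<open>lipschitz_modification_off_subspace\<close>). The glued map \<open>h\<close> has derivative less
    than some \<open>M\<close> on \<open>Y\<close>, hence on an open \<open>U\<close> that contains \<open>Y\<close>, but \<open>U\<close> may become arbitrarily
    thin. At distance about \<open>4\<^sup>-\<^sup>n\<close> from \<open>Y\<close>, where \<open>U\<close> is too thin, \<open>h\<close> is replaced by a map \<open>F n\<close>
    that property (*) provides for \<open>h\<close> on \<open>Y\<close> with error \<open>4\<^sup>-\<^sup>n * M\<close>. There all maps involved differ by
    \<open>O(4\<^sup>-\<^sup>n * M)\<close>, so cut-off functions of slope \<open>O(4\<^sup>n)\<close> may be used.

  The cut-off functions must be scalar, whereas property (*) speaks of \<open>Z\<close>-valued maps: approximate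
  \<open>x \<mapsto> d(x) z\<close> for a distance function \<open>d\<close> and some \<open>z \<noteq> 0\<close>, and apply a bounded functional that
  takes the value \<open>1\<close> at \<open>z\<close>. The functional is a minimal sublinear function below the norm, by the
  Hahn-Banach argument. If \<open>Z = {0}\<close> there is nothing to prove.

  A \<open>C\<^sup>1\<close> smooth \<open>f\<close> that is not Lipschitz is first approximated by an \<open>h\<close> such that the derivative of
  \<open>f - h\<close> along \<open>Y\<close> is bounded by \<open>1\<close>; then \<open>f - h\<close> is extended.
\<close>

section \<open>Bounded functionals\<close>

definition sublinear :: "('b::real_normed_vector \<Rightarrow> real) \<Rightarrow> bool" where
  "sublinear p \<longleftrightarrow> (\<forall>x y. p (x + y) \<le> p x + p y) \<and> (\<forall>t x. 0 \<le> t \<longrightarrow> p (t *\<^sub>R x) = t * p x)"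

lemma sublinear_ge_neg: "sublinear p \<Longrightarrow> - p (- x) \<le> p x"
proof -
  assume p: "sublinear p"
  have "p (0 *\<^sub>R x) = 0 * p x" "p (x + - x) \<le> p x + p (- x)"
    using p unfolding sublinear_def by blast+
  then show ?thesis by simp
qed

text \<open>
  This is a sublinear function below \<open>p\<close>; that it is at most \<open>p (x + y) - p y\<close> is the point. A minimal
  \<open>p\<close> has to coincide with it and is then superadditive.
\<close>

definition lower_along :: "('b::real_normed_vector \<Rightarrow> real) \<Rightarrow> 'b \<Rightarrow> 'b \<Rightarrow> real" where
  "lower_along p y x = (INF t\<in>{0..}. p (x + t *\<^sub>R y) - t * p y)"

lemma
  assumes p: "sublinear p"
  shows sublinear_lower_along: "sublinear (lower_along p y)"
    and lower_along_le: "0 \<le> t \<Longrightarrow> lower_along p y x \<le> p (x + t *\<^sub>R y) - t * p y"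
proof -
  have add: "p (a + b) \<le> p a + p b" for a b using p by (simp add: sublinear_def)
  have hom: "0 \<le> t \<Longrightarrow> p (t *\<^sub>R a) = t * p a" for t a using p by (simp add: sublinear_def)
  have low: "- p (- x) \<le> p (x + t *\<^sub>R y) - t * p y" if "0 \<le> t" for x t
    using add[of "x + t *\<^sub>R y" "- x"] hom[OF that, of y] by simp
  have bdd: "bdd_below ((\<lambda>t. p (x + t *\<^sub>R y) - t * p y) ` {0..})" for x
    using low[of _ x] by (intro bdd_belowI2[of _ "- p (- x)"]) auto
  show le: "0 \<le> t \<Longrightarrow> lower_along p y x \<le> p (x + t *\<^sub>R y) - t * p y" for x t
    unfolding lower_along_def by (rule cINF_lower[OF bdd]) auto
  have ge: "(\<And>t. 0 \<le> t \<Longrightarrow> m \<le> p (x + t *\<^sub>R y) - t * p y) \<Longrightarrow> m \<le> lower_along p y x" for m x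
    unfolding lower_along_def by (rule cINF_greatest) auto
  have "lower_along p y (a + b) \<le> lower_along p y a + lower_along p y b" for a b
  proof -
    have "lower_along p y (a + b) - (p (b + t *\<^sub>R y) - t * p y) \<le> p (a + s *\<^sub>R y) - s * p y"
      if "0 \<le> s" "0 \<le> t" for s t
      using le[of "s + t" "a + b"] add[of "a + s *\<^sub>R y" "b + t *\<^sub>R y"] that
      by (simp add: algebra_simps)
    then have "lower_along p y (a + b) - (p (b + t *\<^sub>R y) - t * p y) \<le> lower_along p y a"
      if "0 \<le> t" for t using that by (intro ge) auto
    then have "lower_along p y (a + b) - lower_along p y a \<le> lower_along p y b"
      by (intro ge) (fastforce simp: algebra_simps)
    then show ?thesis by simp
  qed
  moreover have "lower_along p y (c *\<^sub>R a) = c * lower_along p y a" if "0 \<le> c" for c a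
  proof (cases "c = 0")
    case True
    have "lower_along p y 0 \<le> 0" using le[of 0 0] hom[of 0 0] by simp
    moreover have "0 \<le> lower_along p y 0" by (rule ge) (use hom[of _ y] in simp)
    ultimately show ?thesis using True by simp
  next
    case False
    then have c: "0 < c" using that by simp
    have 1: "lower_along p y (c *\<^sub>R a) \<le> c * lower_along p y a" if c: "0 < c" for c a
    proof -
      have "lower_along p y (c *\<^sub>R a) / c \<le> lower_along p y a"
      proof (rule ge)
        fix t :: real assume t: "0 \<le> t"
        have "lower_along p y (c *\<^sub>R a) \<le> p (c *\<^sub>R a + (c * t) *\<^sub>R y) - (c * t) * p y"
          using t c by (intro le) simp
        also have "c *\<^sub>R a + (c * t) *\<^sub>R y = c *\<^sub>R (a + t *\<^sub>R y)" by (simp add: algebra_simps)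
        also have "p \<dots> = c * p (a + t *\<^sub>R y)" using c by (intro hom) simp
        finally show "lower_along p y (c *\<^sub>R a) / c \<le> p (a + t *\<^sub>R y) - t * p y"
          using c by (simp add: field_simps)
      qed
      then show ?thesis using c by (simp add: field_simps)
    qed
    from 1[OF c, of a] 1[of "inverse c" "c *\<^sub>R a"] c show ?thesis
      by (simp add: field_simps)
  qed
  ultimately show "sublinear (lower_along p y)" by (simp add: sublinear_def)
qed

lemma sublinear_norm: "sublinear norm"
  by (simp add: sublinear_def norm_triangle_ineq)

text \<open>
  For two elements of a chain the smaller one serves for both summands, so subadditivity survives the
  infimum.
\<close>

lemma sublinear_INF_chain:
  assumes "C \<noteq> {}" and sub: "\<And>p. p \<in> C \<Longrightarrow> sublinear p"
    and chain: "\<And>p q. p \<in> C \<Longrightarrow> q \<in> C \<Longrightarrow> p \<le> q \<or> q \<le> p"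
    and bdd: "\<And>x. bdd_below ((\<lambda>p. p x) ` C)"
  shows "sublinear (\<lambda>x. INF p\<in>C. p x)"
proof -
  let ?u = "\<lambda>x. INF p\<in>C. p x"
  have le: "?u x \<le> p x" if "p \<in> C" for p x by (rule cINF_lower[OF bdd that])
  have ge: "(\<And>p. p \<in> C \<Longrightarrow> m \<le> p x) \<Longrightarrow> m \<le> ?u x" for m x
    using assms(1) by (rule cINF_greatest)
  have "?u (x + y) \<le> ?u x + ?u y" for x y
  proof -
    have "?u (x + y) \<le> p x + q y" if pq: "p \<in> C" "q \<in> C" for p q
    proof -
      obtain m where m: "m \<in> C" "m \<le> p" "m \<le> q" using chain[OF pq] pq by blast
      have "?u (x + y) \<le> m (x + y)" by (rule le[OF m(1)])
      also have "\<dots> \<le> m x + m y" using sub[OF m(1)] by (simp add: sublinear_def)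
      also have "\<dots> \<le> p x + q y" using m(2,3) by (intro add_mono) (auto simp: le_fun_def)
      finally show ?thesis .
    qed
    then have "?u (x + y) - q y \<le> ?u x" if "q \<in> C" for q using that by (intro ge) fastforce
    then have "?u (x + y) - ?u x \<le> ?u y" by (intro ge) fastforce
    then show ?thesis by simp
  qed
  moreover have "?u (t *\<^sub>R x) = t * ?u x" if t: "0 \<le> t" for t x
  proof -
    have hom: "p (s *\<^sub>R z) = s * p z" if "p \<in> C" "0 \<le> s" for p s z
      using sub[OF that(1)] that(2) by (simp add: sublinear_def)
    show ?thesis
    proof (cases "t = 0")
      case True
      have "(\<lambda>p. p 0) ` C = {0}"
        using hom[of _ 0 0] assms(1) by (force simp: image_iff)
      then show ?thesis using True by simp
    next
      case False
      then have t: "0 < t" using t by simp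
      have "?u (t *\<^sub>R x) / t \<le> ?u x"
      proof (rule ge)
        fix p assume p: "p \<in> C"
        then show "?u (t *\<^sub>R x) / t \<le> p x"
          using le[OF p, of "t *\<^sub>R x"] hom[OF p, of t x] t by (simp add: field_simps)
      qed
      moreover have "t * ?u x \<le> ?u (t *\<^sub>R x)"
      proof (rule ge)
        fix p assume p: "p \<in> C"
        then show "t * ?u x \<le> p (t *\<^sub>R x)"
          using le[OF p, of x] hom[OF p, of t x] t by simp
      qed
      ultimately show ?thesis using t by (simp add: field_simps)
    qed
  qed
  ultimately show ?thesis by (simp add: sublinear_def)
qed

lemma minimal_sublinear_exists:
  fixes p0 :: "'b::real_normed_vector \<Rightarrow> real"
  assumes p0: "sublinear p0"
  shows "\<exists>p. sublinear p \<and> p \<le> p0 \<and> (\<forall>q. sublinear q \<and> q \<le> p \<longrightarrow> q = p)"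
proof -
  let ?A = "{p. sublinear p \<and> p \<le> p0}"
  have "\<exists>p\<in>?A. \<forall>q\<in>?A. q \<le> p \<longrightarrow> q = p"
  proof (rule predicate_Zorn)
    show "partial_order_on ?A (relation_of (\<lambda>p q. q \<le> p) ?A)"
      by (rule partial_order_on_relation_ofI) (auto intro: order_trans)
    fix C assume C: "C \<in> Chains (relation_of (\<lambda>p q. q \<le> p) ?A)"
    then have CA: "p \<in> ?A" if "p \<in> C" for p
      using that by (auto simp: Chains_def relation_of_def)
    have chain: "p \<le> q \<or> q \<le> p" if "p \<in> C" "q \<in> C" for p q
      using C that by (auto simp: Chains_def relation_of_def)
    show "\<exists>u\<in>?A. \<forall>p\<in>C. u \<le> p"
    proof (cases "C = {}")
      case True
      then show ?thesis using p0 by auto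
    next
      case False
      have bdd: "bdd_below ((\<lambda>p. p x) ` C)" for x
      proof (rule bdd_belowI2)
        fix p assume "p \<in> C"
        then have "sublinear p" "p (- x) \<le> p0 (- x)" using CA[of p] by (auto simp: le_fun_def)
        then show "- p0 (- x) \<le> p x" using sublinear_ge_neg[of p x] by linarith
      qed
      let ?u = "\<lambda>x. INF p\<in>C. p x"
      have le: "?u \<le> p" if "p \<in> C" for p
        using cINF_lower[OF bdd that] by (simp add: le_fun_def)
      have "sublinear ?u"
        using False CA chain bdd by (intro sublinear_INF_chain) auto
      moreover have "?u \<le> p0" using False le CA by (blast intro: order_trans)
      ultimately show ?thesis using le by blast
    qed
  qed
  then show ?thesis by (blast intro: order_trans)
qed

lemma linear_minimal_sublinear:
  assumes p: "sublinear p" and min: "\<And>q. sublinear q \<Longrightarrow> q \<le> p \<Longrightarrow> q = p"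
  shows "linear p"
proof -
  have add: "p (x + y) = p x + p y" for x y
  proof -
    have "lower_along p y \<le> p"
      using lower_along_le[OF p, of 0 y] by (simp add: le_fun_def)
    then have "lower_along p y = p" using min sublinear_lower_along[OF p] by blast
    then have "p x \<le> p (x + y) - p y" using lower_along_le[OF p, of 1 y x] by simp
    moreover have "p (x + y) \<le> p x + p y" using p by (simp add: sublinear_def)
    ultimately show ?thesis by simp
  qed
  have hom: "0 \<le> t \<Longrightarrow> p (t *\<^sub>R x) = t * p x" for t x using p by (simp add: sublinear_def)
  have "p 0 = 0" using hom[of 0 0] by simp
  then have neg: "p (- x) = - p x" for x using add[of x "- x"] by simp
  have "p (t *\<^sub>R x) = t * p x" for t x
    using hom[of t x] hom[of "- t" x] neg[of "t *\<^sub>R x"] by (cases "0 \<le> t") auto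
  then show ?thesis using add by (intro linearI) auto
qed

text \<open>
  Starting the minimisation from \<open>lower_along norm z\<close>, whose value at \<open>- z\<close> is at most \<open>- norm z\<close>,
  forces the minimal, hence linear, function to be nonzero at \<open>z\<close>.
\<close>

lemma exists_functional_eq_one:
  fixes z :: "'b::real_normed_vector"
  assumes "z \<noteq> 0"
  shows "\<exists>\<phi> :: 'b \<Rightarrow>\<^sub>L real. \<phi> z = 1"
proof -
  obtain p where p: "sublinear p" "p \<le> lower_along norm z"
    "\<And>q. sublinear q \<Longrightarrow> q \<le> p \<Longrightarrow> q = p"
    using minimal_sublinear_exists[OF sublinear_lower_along[OF sublinear_norm, of z]] by blast
  have lin: "linear p" using p by (intro linear_minimal_sublinear)
  have le: "p x \<le> norm x" for x
    using p(2) lower_along_le[OF sublinear_norm, of 0 z x] by (auto simp: le_fun_def intro: order_trans)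
  have "bounded_linear p"
  proof (rule bounded_linear_intro[of p 1])
    fix x show "norm (p x) \<le> norm x * 1"
      using le[of x] le[of "- x"] linear_neg[OF lin, of x] by (simp add: abs_le_iff)
  qed (use lin in \<open>simp_all add: linear_add linear_scale\<close>)
  then have app: "blinfun_apply (Blinfun p) = p" by (rule bounded_linear_Blinfun_apply)
  have "p (- z) \<le> - norm z"
    using p(2) lower_along_le[OF sublinear_norm, of 1 z "- z"] by (auto simp: le_fun_def intro: order_trans)
  then have "p z > 0" using assms linear_neg[OF lin, of z] by (simp add: less_le_trans[of 0 "norm z"])
  then have "blinfun_apply ((1 / p z) *\<^sub>R Blinfun p) z = 1"
    by (simp add: scaleR_blinfun.rep_eq app)
  then show ?thesis by blast
qed

section \<open>Continuous differentiability at a point\<close>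

text \<open>
  Having the derivative as a total operator with values in the space of bounded linear maps lets
  continuity and bounds of derivatives be stated without naming a derivative; its values are
  meaningful only where the map is differentiable. The predicate \<open>C1_at\<close> asks for differentiability
  near the point, so it depends only on the germ of the map, and the constructions below may be
  checked locally.
\<close>

definition fderiv :: "('a::real_normed_vector \<Rightarrow> 'b::real_normed_vector) \<Rightarrow> 'a \<Rightarrow> 'a \<Rightarrow>\<^sub>L 'b" where
  "fderiv f x = Blinfun (frechet_derivative f (at x))"

definition C1_at :: "('a::real_normed_vector \<Rightarrow> 'b::real_normed_vector) \<Rightarrow> 'a \<Rightarrow> bool" where
  "C1_at f x \<longleftrightarrow> (\<forall>\<^sub>F z in nhds x. f differentiable (at z)) \<and> isCont (fderiv f) x"

lemma has_derivative_fderiv: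
  assumes "f differentiable (at x)"
  shows "(f has_derivative blinfun_apply (fderiv f x)) (at x)"
proof -
  have "(f has_derivative frechet_derivative f (at x)) (at x)"
    using assms by (simp add: frechet_derivative_works)
  then show ?thesis
    unfolding fderiv_def using has_derivative_bounded_linear bounded_linear_Blinfun_apply by metis
qed

lemma fderiv_eqI: "(f has_derivative blinfun_apply T) (at x) \<Longrightarrow> fderiv f x = T"
  unfolding fderiv_def by (metis frechet_derivative_at blinfun_apply_inverse)

lemma C1_at_has_derivative: "C1_at f x \<Longrightarrow> (f has_derivative blinfun_apply (fderiv f x)) (at x)"
  unfolding C1_at_def by (intro has_derivative_fderiv) (auto dest: eventually_nhds_x_imp_x)

lemma C1_at_eventually_has_derivative:
  "C1_at f x \<Longrightarrow> \<forall>\<^sub>F z in nhds x. (f has_derivative blinfun_apply (fderiv f z)) (at z)"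
  unfolding C1_at_def by (auto elim!: eventually_mono intro: has_derivative_fderiv)

lemma isCont_cong_eventually:
  assumes "\<forall>\<^sub>F z in nhds x. f z = g z" "isCont f x" shows "isCont g x"
  using assms isCont_cong by blast

lemma
  assumes "\<forall>\<^sub>F z in nhds x. (f has_derivative blinfun_apply (f' z)) (at z)" "isCont f' x"
  shows C1_atI: "C1_at f x" and fderiv_eventually_eqI: "fderiv f x = f' x"
proof -
  have ev: "\<forall>\<^sub>F z in nhds x. f' z = fderiv f z"
    using assms(1) by eventually_elim (simp add: fderiv_eqI)
  then show "fderiv f x = f' x" by (auto dest: eventually_nhds_x_imp_x)
  show "C1_at f x"
    unfolding C1_at_def
    using assms(1) isCont_cong_eventually[OF ev assms(2)]
    by (auto elim!: eventually_mono simp: differentiable_def)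
qed

lemma
  assumes "C1_at f x" "\<forall>\<^sub>F z in nhds x. f z = g z"
  shows C1_at_transform: "C1_at g x" and fderiv_transform: "fderiv g x = fderiv f x"
proof -
  have "\<forall>\<^sub>F z in nhds x. \<forall>\<^sub>F w in nhds z. f w = g w"
    using assms(2) by (simp add: eventually_eventually)
  with C1_at_eventually_has_derivative[OF assms(1)]
  have ev: "\<forall>\<^sub>F z in nhds x. (g has_derivative blinfun_apply (fderiv f z)) (at z)"
  proof eventually_elim
    case (elim z)
    have "\<forall>\<^sub>F w in at z. f w = g w" "f z = g z"
      using elim(2) by (auto simp: eventually_nhds_conv_at)
    with elim(1) show ?case
      by (rule has_derivative_transform_eventually) auto
  qed
  have c: "isCont (fderiv f) x" using assms(1) by (simp add: C1_at_def)
  show "C1_at g x" "fderiv g x = fderiv f x"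
    using C1_atI[OF ev c] fderiv_eventually_eqI[OF ev c] by auto
qed

lemma C1_smooth_iff_C1_at: "C1_smooth f \<longleftrightarrow> (\<forall>x. C1_at f x)"
proof
  assume "C1_smooth f"
  then obtain f' where f': "\<And>x. (f has_derivative blinfun_apply (f' x)) (at x)" "continuous_on UNIV f'"
    by (auto simp: C1_smooth_def)
  then show "\<forall>x. C1_at f x"
    by (auto intro!: C1_atI[where f' = f'] simp: continuous_on_eq_continuous_at)
next
  assume "\<forall>x. C1_at f x"
  then show "C1_smooth f"
    unfolding C1_smooth_def
    by (intro exI[of _ "fderiv f"])
      (auto simp: C1_at_has_derivative C1_at_def continuous_on_eq_continuous_at)
qed

lemma
  shows C1_at_const [simp]: "C1_at (\<lambda>_. c) x" and fderiv_const [simp]: "fderiv (\<lambda>_. c) x = 0"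
proof -
  have 1: "\<forall>\<^sub>F z in nhds x. ((\<lambda>_. c) has_derivative blinfun_apply 0) (at z)"
    by (simp add: blinfun.zero_left[abs_def])
  show "C1_at (\<lambda>_. c) x" "fderiv (\<lambda>_. c) x = 0"
    using C1_atI[OF 1] fderiv_eventually_eqI[OF 1] by auto
qed

lemma
  assumes "C1_at f x" "C1_at g x"
  shows C1_at_add: "C1_at (\<lambda>x. f x + g x) x"
    and fderiv_add: "fderiv (\<lambda>x. f x + g x) x = fderiv f x + fderiv g x"
proof -
  have 1: "\<forall>\<^sub>F z in nhds x. ((\<lambda>x. f x + g x) has_derivative blinfun_apply (fderiv f z + fderiv g z)) (at z)"
    using assms[THEN C1_at_eventually_has_derivative]
    by eventually_elim (auto intro!: derivative_eq_intros simp: blinfun.add_left)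
  have 2: "isCont (\<lambda>z. fderiv f z + fderiv g z) x" using assms by (auto simp: C1_at_def)
  show "C1_at (\<lambda>x. f x + g x) x" "fderiv (\<lambda>x. f x + g x) x = fderiv f x + fderiv g x"
    using C1_atI[OF 1 2] fderiv_eventually_eqI[OF 1 2] by auto
qed

lemma
  assumes "C1_at f x" "C1_at g x"
  shows C1_at_diff: "C1_at (\<lambda>x. f x - g x) x"
    and fderiv_diff: "fderiv (\<lambda>x. f x - g x) x = fderiv f x - fderiv g x"
proof -
  have 1: "\<forall>\<^sub>F z in nhds x. ((\<lambda>x. f x - g x) has_derivative blinfun_apply (fderiv f z - fderiv g z)) (at z)"
    using assms[THEN C1_at_eventually_has_derivative]
    by eventually_elim (auto intro!: derivative_eq_intros simp: blinfun.diff_left)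
  have 2: "isCont (\<lambda>z. fderiv f z - fderiv g z) x" using assms by (auto simp: C1_at_def)
  show "C1_at (\<lambda>x. f x - g x) x" "fderiv (\<lambda>x. f x - g x) x = fderiv f x - fderiv g x"
    using C1_atI[OF 1 2] fderiv_eventually_eqI[OF 1 2] by auto
qed

lemma
  assumes "\<And>i. i \<in> I \<Longrightarrow> C1_at (f i) x"
  shows C1_at_sum: "C1_at (\<lambda>x. \<Sum>i\<in>I. f i x) x"
    and fderiv_sum: "fderiv (\<lambda>x. \<Sum>i\<in>I. f i x) x = (\<Sum>i\<in>I. fderiv (f i) x)"
proof -
  have "C1_at (\<lambda>x. \<Sum>i\<in>I. f i x) x \<and> fderiv (\<lambda>x. \<Sum>i\<in>I. f i x) x = (\<Sum>i\<in>I. fderiv (f i) x)"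
    using assms by (induction I rule: infinite_finite_induct) (auto simp: C1_at_add fderiv_add)
  then show "C1_at (\<lambda>x. \<Sum>i\<in>I. f i x) x" "fderiv (\<lambda>x. \<Sum>i\<in>I. f i x) x = (\<Sum>i\<in>I. fderiv (f i) x)"
    by auto
qed

text \<open>
  The rank-one map \<open>x \<mapsto> a x v\<close>, which is the second term of the product rule for a scalar
  function times a vector-valued one.
\<close>

definition outer :: "'b::real_normed_vector \<Rightarrow> ('a::real_normed_vector \<Rightarrow>\<^sub>L real) \<Rightarrow> 'a \<Rightarrow>\<^sub>L 'b" where
  "outer v a = blinfun_scaleR_left v o\<^sub>L a"

lemma outer_apply [simp]: "outer v a x = a x *\<^sub>R v"
  by (simp add: outer_def)

lemma outer_zero [simp]: "outer 0 a = 0" "outer v 0 = 0"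
  by (auto intro!: blinfun_eqI simp: blinfun.bilinear_simps)

lemma outer_diff_left: "outer (v - w) a = outer v a - outer w a"
  by (auto intro!: blinfun_eqI simp: blinfun.bilinear_simps algebra_simps)

lemma outer_sum_right: "outer v (\<Sum>i\<in>I. a i) = (\<Sum>i\<in>I. outer v (a i))"
  by (auto intro!: blinfun_eqI simp: blinfun.bilinear_simps scaleR_sum_left)

lemma norm_outer_le: "norm (outer v a) \<le> norm a * norm v"
proof (rule norm_blinfun_bound)
  fix x show "norm (outer v a x) \<le> norm a * norm v * norm x"
    using mult_right_mono[OF norm_blinfun[of a x], of "norm v"] by (simp add: ac_simps)
qed simp

lemma isCont_outer:
  assumes "isCont f x" "isCont g x"
  shows "isCont (\<lambda>z. outer (f z) (g z)) x"
  unfolding outer_def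
  using assms by (intro bounded_bilinear.isCont[OF bounded_bilinear_blinfun_compose]
      bounded_linear.isCont[OF bounded_linear_blinfun_scaleR_left])

lemma
  assumes "C1_at a x" "C1_at f x"
  shows C1_at_scaleR: "C1_at (\<lambda>x. a x *\<^sub>R f x) x"
    and fderiv_scaleR: "fderiv (\<lambda>x. a x *\<^sub>R f x) x = a x *\<^sub>R fderiv f x + outer (f x) (fderiv a x)"
proof -
  have 1: "\<forall>\<^sub>F z in nhds x. ((\<lambda>x. a x *\<^sub>R f x) has_derivative
      blinfun_apply (a z *\<^sub>R fderiv f z + outer (f z) (fderiv a z))) (at z)"
    using assms[THEN C1_at_eventually_has_derivative]
    by eventually_elim (auto intro!: derivative_eq_intros simp: blinfun.bilinear_simps)
  have 2: "isCont (\<lambda>z. a z *\<^sub>R fderiv f z + outer (f z) (fderiv a z)) x"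
    using assms assms[THEN C1_at_has_derivative, THEN has_derivative_continuous]
    unfolding C1_at_def by (intro continuous_add continuous_scaleR isCont_outer) auto
  show "C1_at (\<lambda>x. a x *\<^sub>R f x) x"
    "fderiv (\<lambda>x. a x *\<^sub>R f x) x = a x *\<^sub>R fderiv f x + outer (f x) (fderiv a x)"
    using C1_atI[OF 1 2] fderiv_eventually_eqI[OF 1 2] by auto
qed

lemma
  assumes "C1_at f x"
  shows C1_at_blinfun_compose: "C1_at (\<lambda>x. blinfun_apply T (f x)) x"
    and fderiv_blinfun_compose: "fderiv (\<lambda>x. blinfun_apply T (f x)) x = T o\<^sub>L fderiv f x"
proof -
  have 1: "\<forall>\<^sub>F z in nhds x. ((\<lambda>x. blinfun_apply T (f x)) has_derivative
      blinfun_apply (T o\<^sub>L fderiv f z)) (at z)"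
    using C1_at_eventually_has_derivative[OF assms]
    by eventually_elim (auto intro!: derivative_eq_intros simp: blinfun.bilinear_simps)
  have 2: "isCont (\<lambda>z. T o\<^sub>L fderiv f z) x"
    using assms by (auto simp: C1_at_def intro!: bounded_bilinear.isCont[OF bounded_bilinear_blinfun_compose])
  show "C1_at (\<lambda>x. blinfun_apply T (f x)) x"
    "fderiv (\<lambda>x. blinfun_apply T (f x)) x = T o\<^sub>L fderiv f x"
    using C1_atI[OF 1 2] fderiv_eventually_eqI[OF 1 2] by auto
qed

lemma
  fixes f :: "'a::real_normed_vector \<Rightarrow> real"
  assumes "C1_at f x" and s: "\<And>t. (s has_real_derivative s' t) (at t)" and s': "\<And>t. isCont s' t"
  shows C1_at_real_compose: "C1_at (\<lambda>x. s (f x)) x"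
    and fderiv_real_compose: "fderiv (\<lambda>x. s (f x)) x = s' (f x) *\<^sub>R fderiv f x"
proof -
  have 1: "\<forall>\<^sub>F z in nhds x. ((\<lambda>x. s (f x)) has_derivative
      blinfun_apply (s' (f z) *\<^sub>R fderiv f z)) (at z)"
    using C1_at_eventually_has_derivative[OF assms(1)]
  proof eventually_elim
    case (elim z)
    have "(s has_derivative (*) (s' (f z))) (at (f z))"
      using s[of "f z"] by (simp add: has_field_derivative_def)
    from diff_chain_at[OF elim this] show ?case
      by (simp add: o_def blinfun.bilinear_simps[abs_def] scaleR_blinfun.rep_eq)
  qed
  have "isCont f x" using C1_at_has_derivative[OF assms(1)] by (rule has_derivative_continuous)
  then have 2: "isCont (\<lambda>z. s' (f z) *\<^sub>R fderiv f z) x"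
    using assms(1) isCont_o2[OF _ s'] unfolding C1_at_def by (intro continuous_scaleR) auto
  show "C1_at (\<lambda>x. s (f x)) x" "fderiv (\<lambda>x. s (f x)) x = s' (f x) *\<^sub>R fderiv f x"
    using C1_atI[OF 1 2] fderiv_eventually_eqI[OF 1 2] by auto
qed

lemma
  shows C1_at_affine: "C1_at (\<lambda>x. c + blinfun_apply T (x - a)) x"
    and fderiv_affine: "fderiv (\<lambda>x. c + blinfun_apply T (x - a)) x = T"
proof -
  have 1: "\<forall>\<^sub>F z in nhds x. ((\<lambda>x. c + blinfun_apply T (x - a)) has_derivative blinfun_apply T) (at z)"
    by (intro always_eventually allI) (auto intro!: derivative_eq_intros)
  show "C1_at (\<lambda>x. c + blinfun_apply T (x - a)) x" "fderiv (\<lambda>x. c + blinfun_apply T (x - a)) x = T"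
    using C1_atI[OF 1] fderiv_eventually_eqI[OF 1] by auto
qed

lemma lipschitz_on_of_norm_fderiv_le:
  assumes "convex S" "\<And>x. x \<in> S \<Longrightarrow> f differentiable (at x)"
    "\<And>x. x \<in> S \<Longrightarrow> norm (fderiv f x) \<le> K" "0 \<le> K"
  shows "K-lipschitz_on S f"
proof (rule lipschitz_onI)
  fix x y assume "x \<in> S" "y \<in> S"
  then have "norm (f x - f y) \<le> K * norm (x - y)"
    using assms
    by (intro differentiable_bound[OF assms(1), where f' = "\<lambda>x. blinfun_apply (fderiv f x)"])
      (auto simp: norm_blinfun.rep_eq[symmetric] intro: has_derivative_at_withinI has_derivative_fderiv)
  then show "dist (f x) (f y) \<le> K * dist x y" by (simp add: dist_norm)
qed (use assms in auto)

text \<open>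
  Only increments along the line through \<open>x\<close> with direction \<open>v\<close> enter, which makes the estimate
  applicable both to maps on the whole space and to maps on a subspace that contains \<open>v\<close>.
\<close>

lemma norm_derivative_le_of_lipschitz:
  fixes T :: "'a::real_normed_vector \<Rightarrow> 'b::real_normed_vector"
  assumes T: "\<And>c. T (c *\<^sub>R v) = c *\<^sub>R T v"
    and lip: "\<And>t. norm (f (x + t *\<^sub>R v) - f x) \<le> L * norm (t *\<^sub>R v)"
    and d: "\<And>e. e > 0 \<Longrightarrow> \<exists>\<delta>>0. \<forall>t. norm (t *\<^sub>R v) < \<delta> \<longrightarrow>
        norm (f (x + t *\<^sub>R v) - f x - T (t *\<^sub>R v)) \<le> e * norm (t *\<^sub>R v)"
  shows "norm (T v) \<le> L * norm v"
proof (cases "v = 0")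
  case True
  then show ?thesis using T[of 0] by simp
next
  case False
  have "norm (T v) \<le> (L + e) * norm v" if e: "e > 0" for e
  proof -
    obtain \<delta> where \<delta>: "\<delta> > 0" "\<And>t. norm (t *\<^sub>R v) < \<delta> \<Longrightarrow>
        norm (f (x + t *\<^sub>R v) - f x - T (t *\<^sub>R v)) \<le> e * norm (t *\<^sub>R v)"
      using d[OF e] by blast
    define t where "t = \<delta> / (2 * norm v)"
    have t: "t > 0" "norm (t *\<^sub>R v) < \<delta>" using \<delta>(1) False by (auto simp: t_def)
    have "norm (T (t *\<^sub>R v)) \<le> norm (f (x + t *\<^sub>R v) - f x) + norm (f (x + t *\<^sub>R v) - f x - T (t *\<^sub>R v))"
      using norm_triangle_ineq4[of "f (x + t *\<^sub>R v) - f x" "f (x + t *\<^sub>R v) - f x - T (t *\<^sub>R v)"] by simp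
    also have "\<dots> \<le> L * norm (t *\<^sub>R v) + e * norm (t *\<^sub>R v)"
      using lip[of t] \<delta>(2)[OF t(2)] by simp
    finally have "t * norm (T v) \<le> t * ((L + e) * norm v)"
      using t(1) by (simp add: T algebra_simps)
    then show ?thesis using t(1) by simp
  qed
  then have "norm (T v) / norm v \<le> L + e" if "e > 0" for e
    using that False by (simp add: pos_divide_le_eq)
  then have "norm (T v) / norm v \<le> L" by (rule field_le_epsilon)
  then show ?thesis using False by (simp add: pos_divide_le_eq)
qed

lemma norm_fderiv_le_of_lipschitz:
  assumes "K-lipschitz_on UNIV f" "f differentiable (at x)"
  shows "norm (fderiv f x) \<le> K"
proof (rule norm_blinfun_bound)
  show "0 \<le> K" by (rule lipschitz_on_nonneg[OF assms(1)])
  fix v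
  show "norm (fderiv f x v) \<le> K * norm v"
  proof (rule norm_derivative_le_of_lipschitz[where f = f and x = x])
    fix t show "norm (f (x + t *\<^sub>R v) - f x) \<le> K * norm (t *\<^sub>R v)"
      using lipschitz_onD[OF assms(1), of "x + t *\<^sub>R v" x] by (simp add: dist_norm)
  next
    fix e :: real assume "e > 0"
    with has_derivative_fderiv[OF assms(2)] obtain \<delta> where "\<delta> > 0"
      "\<And>y. norm (y - x) < \<delta> \<Longrightarrow> norm (f y - f x - fderiv f x (y - x)) \<le> e * norm (y - x)"
      unfolding has_derivative_at_alt by blast
    then show "\<exists>\<delta>>0. \<forall>t. norm (t *\<^sub>R v) < \<delta> \<longrightarrow>
        norm (f (x + t *\<^sub>R v) - f x - fderiv f x (t *\<^sub>R v)) \<le> e * norm (t *\<^sub>R v)"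
      by (metis add_diff_cancel_left')
  qed (simp add: blinfun.bilinear_simps)
qed

section \<open>Approximation in terms of derivative bounds\<close>

lemma Lip_le:
  assumes "L-lipschitz_on A f" shows "Lip A f \<le> L"
  unfolding Lip_def
proof (rule cSup_least)
  fix r assume "r \<in> insert 0 {norm (f x - f y) / norm (x - y) |x y. x \<in> A \<and> y \<in> A \<and> x \<noteq> y}"
  then show "r \<le> L"
    using lipschitz_onD[OF assms] lipschitz_on_nonneg[OF assms]
    by (auto simp: dist_norm pos_divide_le_eq)
qed simp

lemma lipschitz_on_Lip:
  assumes "Lipschitz_on A f" shows "(Lip A f)-lipschitz_on A f"
proof -
  obtain L where L: "L-lipschitz_on A f" using assms by (auto simp: Lipschitz_on_def)
  let ?S = "insert 0 {norm (f x - f y) / norm (x - y) |x y. x \<in> A \<and> y \<in> A \<and> x \<noteq> y}"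
  have bdd: "bdd_above ?S"
    using lipschitz_onD[OF L] lipschitz_on_nonneg[OF L]
    by (intro bdd_aboveI[of _ L]) (auto simp: dist_norm pos_divide_le_eq)
  show ?thesis
  proof (rule lipschitz_onI)
    show "0 \<le> Lip A f" unfolding Lip_def by (rule cSup_upper[OF _ bdd]) simp
    fix x y assume xy: "x \<in> A" "y \<in> A"
    show "dist (f x) (f y) \<le> Lip A f * dist x y"
    proof (cases "x = y")
      case False
      then have "norm (f x - f y) / norm (x - y) \<le> Lip A f"
        unfolding Lip_def using xy by (intro cSup_upper[OF _ bdd]) auto
      then show ?thesis using False by (simp add: dist_norm pos_divide_le_eq)
    qed simp
  qed
qed

text \<open>
  Property (*) with constant \<open>C0\<close>, restated with a bound on the derivative in place of the least
  Lipschitz constant of the approximation.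
\<close>

definition C1_approximable :: "'a::real_normed_vector itself \<Rightarrow> 'b::real_normed_vector itself \<Rightarrow> real \<Rightarrow> bool" where
  "C1_approximable X Z C0 \<longleftrightarrow> C0 \<ge> 1 \<and>
    (\<forall>(A::'a set) (f::'a \<Rightarrow> 'b) L e. L-lipschitz_on A f \<and> e > 0 \<longrightarrow>
      (\<exists>g. (\<forall>x. C1_at g x \<and> norm (fderiv g x) \<le> C0 * L) \<and> (\<forall>x\<in>A. norm (f x - g x) < e)))"

lemma C1_approximableE:
  fixes f :: "'a::real_normed_vector \<Rightarrow> 'b::real_normed_vector"
  assumes "C1_approximable TYPE('a) TYPE('b) C0" "L-lipschitz_on A f" "e > 0"
  obtains g where "\<And>x. C1_at g x" "\<And>x. norm (fderiv g x) \<le> C0 * L"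
    "\<And>x. x \<in> A \<Longrightarrow> norm (f x - g x) < e"
  using assms unfolding C1_approximable_def by blast

lemma property_star_imp_C1_approximable:
  assumes "property_star TYPE('a::banach) TYPE('b::banach)"
  shows "\<exists>C0. C1_approximable TYPE('a) TYPE('b) C0"
proof -
  obtain C0 :: real where C0: "C0 \<ge> 1" and ex: "\<And>(A::'a set) (f::'a \<Rightarrow> 'b) e. Lipschitz_on A f \<Longrightarrow> e > 0 \<Longrightarrow>
      (\<exists>g::'a \<Rightarrow> 'b. C1_smooth g \<and> Lipschitz_on UNIV g \<and>
          (\<forall>x\<in>A. norm (f x - g x) < e) \<and> Lip UNIV g \<le> C0 * Lip A f)"
    using assms by (auto simp: property_star_def)
  have "\<exists>g. (\<forall>x. C1_at g x \<and> norm (fderiv g x) \<le> C0 * L) \<and> (\<forall>x\<in>A. norm (f x - g x) < e)"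
    if L: "L-lipschitz_on A f" and e: "e > 0" for A :: "'a set" and f :: "'a \<Rightarrow> 'b" and L e
  proof -
    have "Lipschitz_on A f" using L by (auto simp: Lipschitz_on_def)
    then obtain g where g: "C1_smooth g" "Lipschitz_on UNIV g" "\<And>x. x \<in> A \<Longrightarrow> norm (f x - g x) < e"
      "Lip UNIV g \<le> C0 * Lip A f" using ex[OF _ e] by blast
    have C1: "C1_at g x" for x using g(1) by (simp add: C1_smooth_iff_C1_at)
    have "norm (fderiv g x) \<le> C0 * L" for x
    proof -
      have "norm (fderiv g x) \<le> Lip UNIV g"
        using norm_fderiv_le_of_lipschitz[OF lipschitz_on_Lip[OF g(2)]] C1_at_has_derivative[OF C1]
        by (auto simp: differentiable_def)
      also have "\<dots> \<le> C0 * Lip A f" by fact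
      also have "\<dots> \<le> C0 * L" using Lip_le[OF L] C0 by (simp add: mult_left_mono)
      finally show ?thesis .
    qed
    then show ?thesis using C1 g(3) by blast
  qed
  then show ?thesis using C0 by (auto simp: C1_approximable_def)
qed

section \<open>Smooth bump functions\<close>

lemma has_real_derivative_pos_part_square:
  "((\<lambda>t::real. (max 0 t)\<^sup>2) has_real_derivative 2 * max 0 t) (at t)"
proof -
  consider "t < 0" | "t = 0" | "t > 0" by linarith
  then show ?thesis
  proof cases
    case 1
    have "((\<lambda>t::real. 0) has_real_derivative 2 * max 0 t) (at t)" using 1 by simp
    then show ?thesis
      by (rule has_field_derivative_transform_within_open[of _ _ _ "{..<0}"]) (use 1 in auto)
  next
    case 3
    have "((\<lambda>t::real. t\<^sup>2) has_real_derivative 2 * max 0 t) (at t)"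
      using 3 by (auto intro!: derivative_eq_intros)
    then show ?thesis
      by (rule has_field_derivative_transform_within_open[of _ _ _ "{0<..}"]) (use 3 in auto)
  next
    case 2
    have "((\<lambda>h. ((max 0 h)\<^sup>2 - (max 0 0)\<^sup>2) / h) \<longlongrightarrow> 0) (at (0::real))"
    proof (rule Lim_null_comparison)
      show "\<forall>\<^sub>F h in at (0::real). norm (((max 0 h)\<^sup>2 - (max 0 0)\<^sup>2) / h) \<le> \<bar>h\<bar>"
        by (intro always_eventually allI) (auto simp: max_def power2_eq_square)
      show "((\<lambda>h::real. \<bar>h\<bar>) \<longlongrightarrow> 0) (at 0)" by (intro tendsto_eq_intros) auto
    qed
    then show ?thesis using 2 by (simp add: has_field_derivative_iff)
  qed
qed

text \<open>
  The quadratic spline with knots \<open>0\<close>, \<open>1/2\<close> and \<open>1\<close> that decreases from \<open>1\<close> to \<open>0\<close> and whose slope is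
  continuous and at most \<open>2\<close> in absolute value.
\<close>

definition smoothstep :: "real \<Rightarrow> real" where
  "smoothstep t = 1 - (2 * (max 0 t)\<^sup>2 - 4 * (max 0 (t - 1/2))\<^sup>2 + 2 * (max 0 (t - 1))\<^sup>2)"

definition smoothstep' :: "real \<Rightarrow> real" where
  "smoothstep' t = - (4 * max 0 t - 8 * max 0 (t - 1/2) + 4 * max 0 (t - 1))"

lemma has_real_derivative_smoothstep: "(smoothstep has_real_derivative smoothstep' t) (at t)"
proof -
  have shift: "((\<lambda>t. (max 0 (t - c))\<^sup>2) has_real_derivative 2 * max 0 (t - c)) (at t)" for c :: real
    using DERIV_shift[of "\<lambda>t. (max 0 t)\<^sup>2" "2 * max 0 (t - c)" t "- c"]
      has_real_derivative_pos_part_square[of "t - c"] by simp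
  have "(smoothstep has_real_derivative
      0 - (2 * (2 * max 0 t) - 4 * (2 * max 0 (t - 1/2)) + 2 * (2 * max 0 (t - 1)))) (at t)"
    unfolding smoothstep_def[abs_def]
    by (intro DERIV_diff DERIV_add DERIV_const DERIV_cmult has_real_derivative_pos_part_square shift)
  then show ?thesis by (simp add: smoothstep'_def algebra_simps)
qed

lemma isCont_smoothstep': "isCont smoothstep' t"
  unfolding smoothstep'_def[abs_def] by (intro continuous_intros)

lemma smoothstep_eq_1: "t \<le> 0 \<Longrightarrow> smoothstep t = 1"
  by (simp add: smoothstep_def)

lemma smoothstep_eq_0: "1 \<le> t \<Longrightarrow> smoothstep t = 0"
  by (simp add: smoothstep_def power2_eq_square algebra_simps)

lemma abs_smoothstep'_le: "\<bar>smoothstep' t\<bar> \<le> 2"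
  by (simp add: smoothstep'_def max_def)

lemma smoothstep_bounds: "0 \<le> smoothstep t" "smoothstep t \<le> 1"
proof -
  have dec: "smoothstep b \<le> smoothstep a" if "a \<le> b" for a b
  proof (rule DERIV_nonpos_imp_nonincreasing[OF that])
    fix x
    have "smoothstep' x \<le> 0" by (simp add: smoothstep'_def max_def)
    then show "\<exists>y. (smoothstep has_real_derivative y) (at x) \<and> y \<le> 0"
      using has_real_derivative_smoothstep by blast
  qed
  show "0 \<le> smoothstep t" using dec[of t "max 1 t"] smoothstep_eq_0[of "max 1 t"] by simp
  show "smoothstep t \<le> 1" using dec[of "min 0 t" t] smoothstep_eq_1[of "min 0 t"] by simp
qed

text \<open>
  A cut-off function of width \<open>\<delta>\<close> around \<open>S\<close>. The values \<open>0\<close> and \<open>1\<close> are required on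
  neighbourhoods, so that a product with \<open>\<beta>\<close> vanishes together with its derivative far from \<open>S\<close>, and
  a product with \<open>1 - \<beta>\<close> does so on \<open>S\<close>.
\<close>

definition is_bump :: "real \<Rightarrow> 'a::real_normed_vector set \<Rightarrow> real \<Rightarrow> ('a \<Rightarrow> real) \<Rightarrow> bool" where
  "is_bump C S \<delta> \<beta> \<longleftrightarrow>
    (\<forall>x. C1_at \<beta> x \<and> 0 \<le> \<beta> x \<and> \<beta> x \<le> 1 \<and> norm (fderiv \<beta> x) \<le> C / \<delta> \<and>
      ((\<exists>s\<in>S. dist x s < \<delta>) \<or> (\<forall>\<^sub>F z in nhds x. \<beta> z = 0))) \<and>
    (\<forall>s\<in>S. \<forall>\<^sub>F z in nhds s. \<beta> z = 1)"

lemma is_bump_eventually_0: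
  assumes "is_bump C S \<delta> \<beta>" "\<not> (\<exists>s\<in>S. dist x s < \<delta>)"
  shows "\<forall>\<^sub>F z in nhds x. \<beta> z = 0"
  using assms(1)[unfolded is_bump_def, THEN conjunct1, THEN spec, of x] assms(2) by simp

lemma is_bump_eventually_1: "is_bump C S \<delta> \<beta> \<Longrightarrow> s \<in> S \<Longrightarrow> \<forall>\<^sub>F z in nhds s. \<beta> z = 1"
  by (simp add: is_bump_def)

text \<open>
  The distance \<open>u\<close> to \<open>S\<close> is \<open>1\<close>-Lipschitz, so \<open>u z\<close> has a smooth approximation whose
  Lipschitz constant does not depend on \<open>S\<close>. Applying a functional with value \<open>1\<close> at \<open>z\<close> gives a
  scalar \<open>k\<close> that is uniformly close to \<open>u\<close>, and a smooth step function of \<open>k\<close> at scale \<open>\<delta>\<close> is the bump.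
\<close>

lemma bumps_exist:
  assumes approx: "C1_approximable TYPE('a::real_normed_vector) TYPE('b::real_normed_vector) C0"
    and z: "(z::'b) \<noteq> 0"
  shows "\<exists>C>0. \<forall>(S::'a set) \<delta>. \<delta> > 0 \<longrightarrow> (\<exists>\<beta>. is_bump C S \<delta> \<beta>)"
proof -
  obtain \<phi> :: "'b \<Rightarrow>\<^sub>L real" where \<phi>: "\<phi> z = 1" using exists_functional_eq_one[OF z] by blast
  have \<phi>0: "norm \<phi> > 0" using \<phi> by auto
  have C0: "C0 \<ge> 1" using approx by (simp add: C1_approximable_def)
  define C where "C = 8 * norm \<phi> * C0 * norm z"
  have C: "C > 0" using \<phi>0 C0 z by (simp add: C_def)
  have "\<exists>\<beta>. is_bump C S \<delta> \<beta>" if \<delta>: "\<delta> > 0" for S :: "'a set" and \<delta>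
  proof (cases "S = {}")
    case True
    have "is_bump C S \<delta> (\<lambda>_. 0)" using True C \<delta> by (simp add: is_bump_def)
    then show ?thesis by blast
  next
    case False
    define u where "u x = infdist x S" for x
    have u1: "\<bar>u x - u y\<bar> \<le> dist x y" for x y unfolding u_def by (rule infdist_triangle_abs)
    have "(norm z)-lipschitz_on UNIV (\<lambda>x. u x *\<^sub>R z)"
    proof (rule lipschitz_onI)
      fix x y
      have "dist (u x *\<^sub>R z) (u y *\<^sub>R z) = \<bar>u x - u y\<bar> * norm z"
        by (metis dist_norm norm_scaleR scaleR_diff_left)
      also have "\<dots> \<le> dist x y * norm z" by (rule mult_right_mono[OF u1 norm_ge_zero])
      finally show "dist (u x *\<^sub>R z) (u y *\<^sub>R z) \<le> norm z * dist x y" by (simp add: mult.commute)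
    qed simp
    from C1_approximableE[OF approx this, of "\<delta> / (8 * norm \<phi>)"] \<delta> \<phi>0
    obtain g :: "'a \<Rightarrow> 'b" where g: "\<And>x. C1_at g x" "\<And>x. norm (fderiv g x) \<le> C0 * norm z"
      "\<And>x. norm (u x *\<^sub>R z - g x) < \<delta> / (8 * norm \<phi>)"
      by (metis UNIV_I divide_pos_pos zero_less_mult_iff zero_less_numeral)
    define k where "k x = \<phi> (g x)" for x
    have ku: "\<bar>u x - k x\<bar> < \<delta> / 8" for x
    proof -
      have "\<bar>u x - k x\<bar> = norm (\<phi> (u x *\<^sub>R z - g x))"
        by (simp add: k_def blinfun.bilinear_simps \<phi>)
      also have "\<dots> \<le> norm \<phi> * norm (u x *\<^sub>R z - g x)" by (rule norm_blinfun)
      also have "\<dots> < norm \<phi> * (\<delta> / (8 * norm \<phi>))" by (rule mult_strict_left_mono[OF g(3) \<phi>0])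
      also have "\<dots> = \<delta> / 8" using \<phi>0 by simp
      finally show ?thesis .
    qed
    have k: "C1_at k x" "fderiv k x = \<phi> o\<^sub>L fderiv g x" for x
      unfolding k_def[abs_def] by (simp_all add: C1_at_blinfun_compose fderiv_blinfun_compose g)
    \<comment> \<open>rescaled so that it equals 1 where \<open>k \<le> 3 \<delta> / 8\<close> and 0 where \<open>k \<ge> 5 \<delta> / 8\<close>\<close>
    define s where "s t = smoothstep (4 / \<delta> * t - 3 / 2)" for t
    have s: "(s has_real_derivative smoothstep' (4 / \<delta> * t - 3 / 2) * (4 / \<delta>)) (at t)" for t
      unfolding s_def[abs_def]
      by (rule DERIV_chain2[OF has_real_derivative_smoothstep])
        (use \<delta> in \<open>auto intro!: derivative_eq_intros\<close>)
    have s': "isCont (\<lambda>t. smoothstep' (4 / \<delta> * t - 3 / 2) * (4 / \<delta>)) t" for t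
      by (intro continuous_intros isCont_o2[OF _ isCont_smoothstep'])
    define \<beta> where "\<beta> x = s (k x)" for x
    have near1: "\<beta> x = 1" if "u x < \<delta> / 4" for x
      using ku[of x] that \<delta> unfolding \<beta>_def s_def abs_less_iff
      by (intro smoothstep_eq_1) (simp add: field_simps)
    have far0: "\<beta> x = 0" if "u x > 3 * \<delta> / 4" for x
      using ku[of x] that \<delta> unfolding \<beta>_def s_def abs_less_iff
      by (intro smoothstep_eq_0) (simp add: field_simps)
    have cont: "isCont u x" for x unfolding u_def by (intro continuous_intros)
    have "is_bump C S \<delta> \<beta>"
      unfolding is_bump_def
    proof (intro conjI allI ballI)
      fix x
      show "C1_at \<beta> x" unfolding \<beta>_def[abs_def] by (rule C1_at_real_compose[OF k(1) s s'])
      show "0 \<le> \<beta> x" "\<beta> x \<le> 1" by (simp_all add: \<beta>_def s_def smoothstep_bounds)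
      have "norm (fderiv \<beta> x) \<le> (2 * (4 / \<delta>)) * (norm \<phi> * (C0 * norm z))"
        unfolding \<beta>_def[abs_def] fderiv_real_compose[OF k(1) s s'] k(2) norm_scaleR
      proof (rule mult_mono)
        show "\<bar>smoothstep' (4 / \<delta> * k x - 3 / 2) * (4 / \<delta>)\<bar> \<le> 2 * (4 / \<delta>)"
          using \<delta> abs_smoothstep'_le by (simp add: abs_mult divide_right_mono)
        show "norm (\<phi> o\<^sub>L fderiv g x) \<le> norm \<phi> * (C0 * norm z)"
          using norm_blinfun_compose[of \<phi> "fderiv g x"] g(2)[of x]
          by (meson mult_left_mono norm_ge_zero order_trans)
      qed (use \<delta> in auto)
      then show "norm (fderiv \<beta> x) \<le> C / \<delta>" by (simp add: C_def)
      show "(\<exists>s\<in>S. dist x s < \<delta>) \<or> (\<forall>\<^sub>F z in nhds x. \<beta> z = 0)"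
      proof (cases "u x < \<delta>")
        case True
        then show ?thesis
          using False unfolding u_def infdist_notempty[OF False]
          by (subst (asm) cINF_less_iff) auto
      next
        case False
        have "\<forall>\<^sub>F z in nhds x. u z > 3 * \<delta> / 4"
          using order_tendstoD(1)[OF cont[of x, unfolded isCont_def], of "3 * \<delta> / 4"] False \<delta>
          unfolding eventually_nhds_conv_at by simp
        then show ?thesis by (metis (mono_tags, lifting) eventually_mono far0)
      qed
    next
      fix x assume "x \<in> S"
      then have "u x = 0" by (simp add: u_def)
      then have "\<forall>\<^sub>F z in nhds x. u z < \<delta> / 4"
        using order_tendstoD(2)[OF cont[of x, unfolded isCont_def], of "\<delta> / 4"] \<delta>
        unfolding eventually_nhds_conv_at by simp
      then show "\<forall>\<^sub>F z in nhds x. \<beta> z = 1" by (metis (mono_tags, lifting) eventually_mono near1)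
    qed
    then show ?thesis by blast
  qed
  then show ?thesis using C by blast
qed

section \<open>Smooth maps on a subspace\<close>

text \<open>
  The condition in \<open>C1_smooth_on\<close> with the derivative \<open>f'\<close> exposed and with pointwise estimates
  in place of limits of quotients and of operator norms.
\<close>

definition C1_deriv_on :: "'a::real_normed_vector set \<Rightarrow> ('a \<Rightarrow> 'b::real_normed_vector) \<Rightarrow> ('a \<Rightarrow> 'a \<Rightarrow> 'b) \<Rightarrow> bool" where
  "C1_deriv_on Y f f' \<longleftrightarrow> (\<forall>x\<in>Y. bounded_linear_on Y (f' x) \<and>
     (\<forall>e>0. \<exists>d>0. \<forall>y\<in>Y. norm (y - x) < d \<longrightarrow> norm (f y - f x - f' x (y - x)) \<le> e * norm (y - x)) \<and>
     (\<forall>e>0. \<exists>d>0. \<forall>y\<in>Y. norm (y - x) < d \<longrightarrow> (\<forall>v\<in>Y. norm (f' y v - f' x v) \<le> e * norm v)))"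

lemma C1_deriv_on_linear: "C1_deriv_on Y f f' \<Longrightarrow> x \<in> Y \<Longrightarrow> bounded_linear_on Y (f' x)"
  by (simp add: C1_deriv_on_def)

lemma C1_deriv_on_approx:
  assumes "C1_deriv_on Y f f'" "x \<in> Y" "e > 0"
  obtains d where "d > 0"
    "\<And>y. y \<in> Y \<Longrightarrow> norm (y - x) < d \<Longrightarrow> norm (f y - f x - f' x (y - x)) \<le> e * norm (y - x)"
proof -
  have "\<exists>d>0. \<forall>y\<in>Y. norm (y - x) < d \<longrightarrow> norm (f y - f x - f' x (y - x)) \<le> e * norm (y - x)"
    using assms(1)[unfolded C1_deriv_on_def, THEN bspec, OF assms(2), THEN conjunct2, THEN conjunct1]
      assms(3) by (elim allE[of _ e]) simp
  then show ?thesis using that by auto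
qed

lemma C1_deriv_on_continuous:
  assumes "C1_deriv_on Y f f'" "x \<in> Y" "e > 0"
  obtains d where "d > 0"
    "\<And>y v. y \<in> Y \<Longrightarrow> norm (y - x) < d \<Longrightarrow> v \<in> Y \<Longrightarrow> norm (f' y v - f' x v) \<le> e * norm v"
proof -
  have "\<exists>d>0. \<forall>y\<in>Y. norm (y - x) < d \<longrightarrow> (\<forall>v\<in>Y. norm (f' y v - f' x v) \<le> e * norm v)"
    using assms(1)[unfolded C1_deriv_on_def, THEN bspec, OF assms(2), THEN conjunct2, THEN conjunct2]
      assms(3) by (elim allE[of _ e]) simp
  then show ?thesis using that by auto
qed

lemma onorm_on_le:
  assumes "Y \<noteq> {}" "0 \<le> K" "\<And>v. v \<in> Y \<Longrightarrow> norm (T v) \<le> K * norm v"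
  shows "onorm_on Y T \<le> K"
  unfolding onorm_on_def
proof (rule cSUP_least[OF assms(1)])
  fix v assume "v \<in> Y"
  then show "norm (T v) / norm v \<le> K" using assms(2) assms(3)[of v] by (cases "v = 0") (auto simp: pos_divide_le_eq)
qed

lemma norm_le_onorm_on:
  assumes Y: "subspace Y" and T: "bounded_linear_on Y T" and v: "v \<in> Y"
  shows "norm (T v) \<le> onorm_on Y T * norm v"
proof -
  obtain K where K: "\<And>x. x \<in> Y \<Longrightarrow> norm (T x) \<le> norm x * K" using T unfolding bounded_linear_on_def by blast
  have bdd: "bdd_above ((\<lambda>v. norm (T v) / norm v) ` Y)"
  proof (rule bdd_aboveI2)
    fix x assume "x \<in> Y"
    then have "norm (T x) \<le> norm x * max 0 K"
      by (rule order_trans[OF K]) (simp add: mult_left_mono)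
    then show "norm (T x) / norm x \<le> max 0 K"
      by (cases "x = 0") (simp_all add: pos_divide_le_eq mult.commute[of "max 0 K"])
  qed
  have le: "norm (T v) / norm v \<le> onorm_on Y T"
    unfolding onorm_on_def by (rule cSUP_upper[OF v bdd])
  show ?thesis
  proof (cases "v = 0")
    case True
    then show ?thesis using K[OF v] by simp
  next
    case False
    then show ?thesis using le by (simp add: pos_divide_le_eq)
  qed
qed

lemma bounded_linear_on_diff:
  assumes "bounded_linear_on Y S" "bounded_linear_on Y T"
  shows "bounded_linear_on Y (\<lambda>v. S v - T v)"
proof -
  obtain K L where K: "\<And>x. x \<in> Y \<Longrightarrow> norm (S x) \<le> norm x * K" "\<And>x. x \<in> Y \<Longrightarrow> norm (T x) \<le> norm x * L"
    using assms unfolding bounded_linear_on_def by blast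
  have "norm (S x - T x) \<le> norm x * (K + L)" if "x \<in> Y" for x
    using norm_triangle_ineq4[of "S x" "T x"] K[OF that] by (simp add: algebra_simps)
  moreover have "S (x + y) - T (x + y) = (S x - T x) + (S y - T y)" if "x \<in> Y" "y \<in> Y" for x y
    using assms that unfolding bounded_linear_on_def by simp
  moreover have "S (c *\<^sub>R x) - T (c *\<^sub>R x) = c *\<^sub>R (S x - T x)" if "x \<in> Y" for c x
    using assms that unfolding bounded_linear_on_def by (simp add: scaleR_diff_right)
  ultimately show ?thesis unfolding bounded_linear_on_def by blast
qed

lemma C1_smooth_on_iff:
  assumes Y: "subspace Y"
  shows "C1_smooth_on Y f \<longleftrightarrow> (\<exists>f'. C1_deriv_on Y f f')"
proof
  assume "C1_smooth_on Y f"
  then obtain f' where f': "\<And>x. x \<in> Y \<Longrightarrow> bounded_linear_on Y (f' x)"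
    "\<And>x. x \<in> Y \<Longrightarrow> ((\<lambda>y. norm (f y - f x - f' x (y - x)) / norm (y - x)) \<longlongrightarrow> 0) (at x within Y)"
    "\<And>x. x \<in> Y \<Longrightarrow> ((\<lambda>y. onorm_on Y (\<lambda>v. f' y v - f' x v)) \<longlongrightarrow> 0) (at x within Y)"
    by (auto simp: C1_smooth_on_def)
  have "C1_deriv_on Y f f'"
    unfolding C1_deriv_on_def
  proof (intro ballI conjI allI impI)
    fix x e assume x: "x \<in> Y" and e: "(e::real) > 0"
    from f'(2)[OF x] e obtain d where d: "d > 0"
      "\<And>y. y \<in> Y \<Longrightarrow> 0 < dist y x \<Longrightarrow> dist y x < d \<Longrightarrow> norm (f y - f x - f' x (y - x)) / norm (y - x) < e"
      unfolding Lim_within by (fastforce simp: dist_norm)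
    have z: "f' x 0 = 0"
      using norm_le_onorm_on[OF Y f'(1)[OF x], of 0] subspace_0[OF Y] by simp
    show "\<exists>d>0. \<forall>y\<in>Y. norm (y - x) < d \<longrightarrow> norm (f y - f x - f' x (y - x)) \<le> e * norm (y - x)"
    proof (intro exI[of _ d] conjI ballI impI d)
      fix y assume y: "y \<in> Y" "norm (y - x) < d"
      show "norm (f y - f x - f' x (y - x)) \<le> e * norm (y - x)"
        using d(2)[OF y(1)] y z by (cases "y = x") (auto simp: dist_norm pos_divide_less_eq)
    qed
    from f'(3)[OF x] e obtain d where d: "d > 0"
      "\<And>y. y \<in> Y \<Longrightarrow> 0 < dist y x \<Longrightarrow> dist y x < d \<Longrightarrow> onorm_on Y (\<lambda>v. f' y v - f' x v) < e"
      unfolding Lim_within by (fastforce simp: dist_norm)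
    show "\<exists>d>0. \<forall>y\<in>Y. norm (y - x) < d \<longrightarrow> (\<forall>v\<in>Y. norm (f' y v - f' x v) \<le> e * norm v)"
    proof (intro exI[of _ d] conjI ballI impI d)
      fix y v assume y: "y \<in> Y" "norm (y - x) < d" "v \<in> Y"
      show "norm (f' y v - f' x v) \<le> e * norm v"
      proof (cases "y = x")
        case False
        have "norm (f' y v - f' x v) \<le> onorm_on Y (\<lambda>v. f' y v - f' x v) * norm v"
          by (rule norm_le_onorm_on[OF Y bounded_linear_on_diff[OF f'(1)[OF y(1)] f'(1)[OF x]] y(3)])
        also have "\<dots> \<le> e * norm v"
          using d(2)[OF y(1)] y(2) False by (intro mult_right_mono) (auto simp: dist_norm)
        finally show ?thesis .
      qed (use e in auto)
    qed
  qed (rule f')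
  then show "\<exists>f'. C1_deriv_on Y f f'" by blast
next
  assume "\<exists>f'. C1_deriv_on Y f f'"
  then obtain f' where f': "C1_deriv_on Y f f'" by blast
  show "C1_smooth_on Y f"
    unfolding C1_smooth_on_def
  proof (intro exI[of _ f'] ballI conjI)
    fix x assume x: "x \<in> Y"
    show blf: "bounded_linear_on Y (f' x)" using f' x by (simp add: C1_deriv_on_def)
    show "((\<lambda>y. norm (f y - f x - f' x (y - x)) / norm (y - x)) \<longlongrightarrow> 0) (at x within Y)"
      unfolding Lim_within
    proof (intro allI impI)
      fix e :: real assume e: "e > 0"
      then obtain d where d: "d > 0"
        "\<And>y. y \<in> Y \<Longrightarrow> norm (y - x) < d \<Longrightarrow> norm (f y - f x - f' x (y - x)) \<le> e / 2 * norm (y - x)"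
        using C1_deriv_on_approx[OF f' x, of "e / 2"] by auto
      have "norm (f y - f x - f' x (y - x)) / norm (y - x) < e"
        if "y \<in> Y" "0 < dist y x" "dist y x < d" for y
      proof -
        have "norm (f y - f x - f' x (y - x)) / norm (y - x) \<le> e / 2"
          using d(2)[of y] that by (auto simp: dist_norm pos_divide_le_eq)
        then show ?thesis using e by linarith
      qed
      then show "\<exists>d>0. \<forall>y\<in>Y. 0 < dist y x \<and> dist y x < d \<longrightarrow>
          dist (norm (f y - f x - f' x (y - x)) / norm (y - x)) 0 < e"
        using d(1) by (intro exI[of _ d]) auto
    qed
    show "((\<lambda>y. onorm_on Y (\<lambda>v. f' y v - f' x v)) \<longlongrightarrow> 0) (at x within Y)"
      unfolding Lim_within
    proof (intro allI impI)
      fix e :: real assume e: "e > 0"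
      then obtain d where d: "d > 0"
        "\<And>y v. y \<in> Y \<Longrightarrow> norm (y - x) < d \<Longrightarrow> v \<in> Y \<Longrightarrow> norm (f' y v - f' x v) \<le> e / 2 * norm v"
        using C1_deriv_on_continuous[OF f' x, of "e / 2"] by auto
      have "\<bar>onorm_on Y (\<lambda>v. f' y v - f' x v)\<bar> < e"
        if y: "y \<in> Y" "dist y x < d" for y
      proof -
        have "onorm_on Y (\<lambda>v. f' y v - f' x v) \<le> e / 2"
          using d(2)[of y] y e x by (intro onorm_on_le) (auto simp: dist_norm)
        moreover have "0 \<le> onorm_on Y (\<lambda>v. f' y v - f' x v)"
        proof -
          have "bdd_above ((\<lambda>v. norm (f' y v - f' x v) / norm v) ` Y)"
            using d(2)[of y] y e
            by (intro bdd_aboveI2[of _ _ "e / 2"]) (auto simp: dist_norm divide_le_eq)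
          from cSUP_upper[OF subspace_0[OF Y] this] show ?thesis by (simp add: onorm_on_def)
        qed
        ultimately show ?thesis using e by linarith
      qed
      then show "\<exists>d>0. \<forall>y\<in>Y. 0 < dist y x \<and> dist y x < d \<longrightarrow>
          dist (onorm_on Y (\<lambda>v. f' y v - f' x v)) 0 < e"
        using d(1) by (intro exI[of _ d]) auto
    qed
  qed
qed

lemma C1_deriv_on_diff:
  assumes "C1_deriv_on Y f f'" "C1_deriv_on Y g g'"
  shows "C1_deriv_on Y (\<lambda>x. f x - g x) (\<lambda>x v. f' x v - g' x v)"
  unfolding C1_deriv_on_def
proof (intro ballI conjI allI impI)
  fix x assume x: "x \<in> Y"
  show "bounded_linear_on Y (\<lambda>v. f' x v - g' x v)"
    using assms x by (intro bounded_linear_on_diff) (auto simp: C1_deriv_on_def)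
  fix e :: real assume e: "e > 0"
  then have e2: "e / 2 > 0" by simp
  obtain c where c: "c > 0"
    "\<And>y. y \<in> Y \<Longrightarrow> norm (y - x) < c \<Longrightarrow> norm (f y - f x - f' x (y - x)) \<le> e / 2 * norm (y - x)"
    by (rule C1_deriv_on_approx[OF assms(1) x e2]) blast
  obtain d where d: "d > 0"
    "\<And>y. y \<in> Y \<Longrightarrow> norm (y - x) < d \<Longrightarrow> norm (g y - g x - g' x (y - x)) \<le> e / 2 * norm (y - x)"
    by (rule C1_deriv_on_approx[OF assms(2) x e2]) blast
  show "\<exists>d>0. \<forall>y\<in>Y. norm (y - x) < d \<longrightarrow>
      norm (f y - g y - (f x - g x) - (f' x (y - x) - g' x (y - x))) \<le> e * norm (y - x)"
  proof (intro exI[of _ "min c d"] conjI ballI impI)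
    fix y assume y: "y \<in> Y" "norm (y - x) < min c d"
    have "norm (f y - g y - (f x - g x) - (f' x (y - x) - g' x (y - x)))
        \<le> norm (f y - f x - f' x (y - x)) + norm (g y - g x - g' x (y - x))"
      using norm_triangle_ineq4[of "f y - f x - f' x (y - x)" "g y - g x - g' x (y - x)"]
      by (simp add: algebra_simps)
    then show "norm (f y - g y - (f x - g x) - (f' x (y - x) - g' x (y - x))) \<le> e * norm (y - x)"
      using c(2)[OF y(1)] d(2)[OF y(1)] y(2) by simp
  qed (use c d in auto)
  obtain c where c: "c > 0"
    "\<And>y v. y \<in> Y \<Longrightarrow> norm (y - x) < c \<Longrightarrow> v \<in> Y \<Longrightarrow> norm (f' y v - f' x v) \<le> e / 2 * norm v"
    by (rule C1_deriv_on_continuous[OF assms(1) x e2]) blast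
  obtain d where d: "d > 0"
    "\<And>y v. y \<in> Y \<Longrightarrow> norm (y - x) < d \<Longrightarrow> v \<in> Y \<Longrightarrow> norm (g' y v - g' x v) \<le> e / 2 * norm v"
    by (rule C1_deriv_on_continuous[OF assms(2) x e2]) blast
  show "\<exists>d>0. \<forall>y\<in>Y. norm (y - x) < d \<longrightarrow>
      (\<forall>v\<in>Y. norm (f' y v - g' y v - (f' x v - g' x v)) \<le> e * norm v)"
  proof (intro exI[of _ "min c d"] conjI ballI impI)
    fix y v assume y: "y \<in> Y" "norm (y - x) < min c d" "v \<in> Y"
    have "norm (f' y v - g' y v - (f' x v - g' x v)) \<le> norm (f' y v - f' x v) + norm (g' y v - g' x v)"
      using norm_triangle_ineq4[of "f' y v - f' x v" "g' y v - g' x v"] by (simp add: algebra_simps)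
    then show "norm (f' y v - g' y v - (f' x v - g' x v)) \<le> e * norm v"
      using c(2)[OF y(1) _ y(3)] d(2)[OF y(1) _ y(3)] y(2) by simp
  qed (use c d in auto)
qed

lemma C1_deriv_on_fderiv:
  assumes f: "\<And>x. C1_at f x" 
  shows "C1_deriv_on Y f (\<lambda>x. blinfun_apply (fderiv f x))"
  unfolding C1_deriv_on_def
proof (intro ballI conjI allI impI)
  fix x
  show "bounded_linear_on Y (blinfun_apply (fderiv f x))"
    unfolding bounded_linear_on_def using norm_blinfun[of "fderiv f x"]
    by (auto simp: blinfun.bilinear_simps mult.commute intro!: exI[of _ "norm (fderiv f x)"])
  fix e :: real assume e: "e > 0"
  then show "\<exists>d>0. \<forall>y\<in>Y. norm (y - x) < d \<longrightarrow> norm (f y - f x - fderiv f x (y - x)) \<le> e * norm (y - x)"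
    using C1_at_has_derivative[OF f[of x]] unfolding has_derivative_at_alt by blast
  have "isCont (fderiv f) x" using f by (simp add: C1_at_def)
  then obtain d where d: "d > 0" "\<And>y. dist y x < d \<Longrightarrow> dist (fderiv f y) (fderiv f x) < e"
    using e unfolding continuous_at_eps_delta by (auto simp: dist_commute)
  have "norm (fderiv f y v - fderiv f x v) \<le> e * norm v" if "norm (y - x) < d" for y v
  proof -
    have "norm (fderiv f y v - fderiv f x v) \<le> norm (fderiv f y - fderiv f x) * norm v"
      using norm_blinfun[of "fderiv f y - fderiv f x" v] by (simp add: blinfun.diff_left)
    also have "\<dots> \<le> e * norm v"
      using d(2)[of y] that by (intro mult_right_mono) (auto simp: dist_norm)
    finally show ?thesis .
  qed
  then show "\<exists>d>0. \<forall>y\<in>Y. norm (y - x) < d \<longrightarrow> (\<forall>v\<in>Y. norm (fderiv f y v - fderiv f x v) \<le> e * norm v)"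
    using d(1) by blast
qed

text \<open>
  The mean value inequality along the segment from \<open>x\<close> to \<open>y\<close>, on which \<open>f\<close> is a
  differentiable curve although it has no derivative on the ambient space.
\<close>

lemma lipschitz_on_of_C1_deriv_on_bound:
  assumes Y: "subspace Y" and A: "convex A" "A \<subseteq> Y" and f: "C1_deriv_on Y f f'"
    and K: "0 \<le> K" "\<And>x v. x \<in> A \<Longrightarrow> v \<in> Y \<Longrightarrow> norm (f' x v) \<le> K * norm v"
  shows "K-lipschitz_on A f"
proof (rule lipschitz_onI)
  fix x y assume xy: "x \<in> A" "y \<in> A"
  define p where "p t = x + t *\<^sub>R (y - x)" for t :: real
  have vY: "y - x \<in> Y" using xy A(2) by (auto intro: subspace_diff[OF Y])
  have pA: "p t \<in> A" if "t \<in> {0..1}" for t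
    using convexD_alt[OF A(1) xy, of t] that by (simp add: p_def algebra_simps)
  have pd: "p s - p t = (s - t) *\<^sub>R (y - x)" for s t by (simp add: p_def algebra_simps)
  have hom: "f' z (c *\<^sub>R v) = c *\<^sub>R f' z v" if "z \<in> Y" "v \<in> Y" for z c v
    using f that by (simp add: C1_deriv_on_def bounded_linear_on_def)
  have der: "((\<lambda>t. f (p t)) has_derivative (\<lambda>s. s *\<^sub>R f' (p t) (y - x))) (at t within {0..1})"
    if t: "t \<in> {0..1}" for t
    unfolding has_derivative_within_alt
  proof (intro conjI allI impI)
    show "bounded_linear (\<lambda>s. s *\<^sub>R f' (p t) (y - x))" by (rule bounded_linear_scaleR_left)
    fix e :: real assume e: "e > 0"
    define c where "c = e / (norm (y - x) + 1)"
    have c: "c > 0" using e by (simp add: c_def add_nonneg_pos)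
    have pt: "p t \<in> Y" using pA[OF t] A by blast
    obtain d where d: "d > 0" "\<And>z. z \<in> Y \<Longrightarrow> norm (z - p t) < d \<Longrightarrow>
        norm (f z - f (p t) - f' (p t) (z - p t)) \<le> c * norm (z - p t)"
      by (rule C1_deriv_on_approx[OF f pt c]) blast
    define d' where "d' = d / (norm (y - x) + 1)"
    have d': "d' > 0" using d(1) by (simp add: d'_def add_nonneg_pos)
    have "norm (f (p s) - f (p t) - (s - t) *\<^sub>R f' (p t) (y - x)) \<le> e * norm (s - t)"
      if s: "s \<in> {0..1}" "norm (s - t) < d'" for s
    proof -
      have "\<bar>s - t\<bar> * (norm (y - x) + 1) < d"
        using s(2) by (simp add: d'_def pos_less_divide_eq add_nonneg_pos)
      then have "norm (p s - p t) < d" unfolding pd norm_scaleR by (simp add: distrib_left)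
      moreover have "p s \<in> Y" using pA[OF s(1)] A by blast
      ultimately have "norm (f (p s) - f (p t) - f' (p t) (p s - p t)) \<le> c * norm (p s - p t)"
        using d(2) by blast
      then have "norm (f (p s) - f (p t) - (s - t) *\<^sub>R f' (p t) (y - x)) \<le> c * (\<bar>s - t\<bar> * norm (y - x))"
        using hom[OF pt vY] by (simp add: pd)
      also have "\<dots> = \<bar>s - t\<bar> * (c * norm (y - x))" by simp
      also have "\<dots> \<le> \<bar>s - t\<bar> * e"
      proof (rule mult_left_mono)
        have "c * norm (y - x) \<le> c * (norm (y - x) + 1)" using c by (intro mult_left_mono) auto
        also have "\<dots> = e" using norm_ge_zero[of "y - x"] unfolding c_def
          by (simp del: norm_ge_zero add: add_nonneg_eq_0_iff)
        finally show "c * norm (y - x) \<le> e" .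
      qed simp
      finally show ?thesis by (simp add: mult.commute)
    qed
    then show "\<exists>d>0. \<forall>s\<in>{0..1}. norm (s - t) < d \<longrightarrow>
        norm (f (p s) - f (p t) - (s - t) *\<^sub>R f' (p t) (y - x)) \<le> e * norm (s - t)"
      using d' by blast
  qed
  have "norm (f (p 1) - f (p 0)) \<le> (K * norm (y - x)) * norm (1 - 0 :: real)"
  proof (rule differentiable_bound[OF _ der])
    fix t :: real assume t: "t \<in> {0..1}"
    show "onorm (\<lambda>s. s *\<^sub>R f' (p t) (y - x)) \<le> K * norm (y - x)"
    proof (rule onorm_le)
      fix s show "norm (s *\<^sub>R f' (p t) (y - x)) \<le> K * norm (y - x) * norm s"
        using mult_left_mono[OF K(2)[OF pA[OF t] vY], of "\<bar>s\<bar>"] by (simp add: ac_simps)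
    qed
  qed auto
  then show "dist (f x) (f y) \<le> K * dist x y" by (simp add: p_def dist_norm norm_minus_commute)
qed (rule K)

section \<open>Gluing local maps\<close>

text \<open>
  Stone's construction. Well-order the centres and let \<open>T n c\<close> consist of the points that lie in the
  ball around \<open>c\<close> with room \<open>2\<^sup>-\<^sup>n\<close> to spare and in no ball with a smaller centre. Two such sets of the
  same level are \<open>2\<^sup>-\<^sup>n\<close> apart, and the first ball that contains a given point provides a set that
  contains it.
\<close>

lemma sigma_discrete_refinement:
  fixes r :: "'a::metric_space \<Rightarrow> real"
  assumes r: "\<And>x. r x > 0"
  obtains T :: "nat \<Rightarrow> 'a \<Rightarrow> 'a set" where
    "\<And>n c x z. x \<in> T n c \<Longrightarrow> dist x z < (1/2) ^ n \<Longrightarrow> dist c z < r c"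
    "\<And>n c c' x y. x \<in> T n c \<Longrightarrow> y \<in> T n c' \<Longrightarrow> c \<noteq> c' \<Longrightarrow> (1/2) ^ n \<le> dist x y"
    "\<And>x. \<exists>n c. x \<in> T n c"
proof -
  obtain R :: "'a rel" where R: "Well_order R" "Field R = UNIV"
    using well_ordering[where 'a = 'a] by metis
  have wf: "wf (R - Id)" using R(1) by (simp add: well_order_on_def)
  have tot: "(b, c) \<in> R \<or> (c, b) \<in> R" if "b \<noteq> c" for b c
    using R that by (auto simp: well_order_on_def linear_order_on_def total_on_def)
  define T where "T n c = {x. (\<forall>z. dist x z < (1/2) ^ n \<longrightarrow> dist c z < r c) \<and>
      (\<forall>b. (b, c) \<in> R - Id \<longrightarrow> \<not> dist b x < r b)}" for n :: nat and c
  show thesis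
  proof
    show "dist c z < r c" if "x \<in> T n c" "dist x z < (1/2) ^ n" for n c x z
      using that by (simp add: T_def)
    show "(1/2) ^ n \<le> dist x y" if xy: "x \<in> T n c" "y \<in> T n c'" "c \<noteq> c'" for n c c' x y
    proof (rule ccontr)
      assume "\<not> ?thesis"
      then have d: "dist x y < (1/2) ^ n" "dist y x < (1/2) ^ n" by (auto simp: dist_commute)
      have "dist c y < r c" "dist c' x < r c'" using xy d by (auto simp: T_def)
      moreover have "(c, c') \<in> R - Id \<or> (c', c) \<in> R - Id" using tot[OF xy(3)] xy(3) by auto
      ultimately show False using xy by (auto simp: T_def)
    qed
    show "\<exists>n c. x \<in> T n c" for x
    proof -
      have "x \<in> {c. dist c x < r c}" using r[of x] by simp
      then obtain c where c: "dist c x < r c" "\<And>b. (b, c) \<in> R - Id \<Longrightarrow> \<not> dist b x < r b"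
        using wfE_min[OF wf, of x "{c. dist c x < r c}"] by auto
      obtain n where n: "(1/2) ^ n < r c - dist c x"
        using real_arch_pow_inv[of "r c - dist c x" "1/2"] c(1) by auto
      have "dist c z < r c" if "dist x z < (1/2) ^ n" for z
        using dist_triangle[of c z x] that n by linarith
      then have "x \<in> T n c" using c(2) by (auto simp: T_def)
      then show ?thesis by blast
    qed
  qed
qed

text \<open>
  For each level \<open>n\<close> a single bump \<open>\<beta> n\<close> around the union of the well separated sets \<open>T n c\<close> is
  enough: near a point at most one \<open>c\<close> is active. The weights \<open>\<phi> n = \<beta> n * (\<Prod>m<n. 1 - \<beta> m)\<close>
  form a partition of unity that is locally finite, because at a point of \<open>T N c\<close> the factor
  \<open>1 - \<beta> N\<close> vanishes nearby and kills all later weights; their slope is at most \<open>12 * C * 2 ^ n\<close>.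

  The conclusion says that the derivative of the glued map is a convex combination of the derivatives
  of the maps that are active at \<open>y\<close>, up to an error controlled by how far their values at \<open>y\<close> are
  from any one vector \<open>q\<close>. The dependence of \<open>P\<close> on the level \<open>n\<close> allows this error to be made
  summable.
\<close>

lemma glue_local_C1_maps:
  fixes P :: "nat \<Rightarrow> 'a::real_normed_vector \<Rightarrow> 'a \<Rightarrow> 'b::real_normed_vector" and r :: "'a \<Rightarrow> real"
  assumes bumps: "\<And>(S::'a set) \<delta>. \<delta> > 0 \<Longrightarrow> \<exists>\<beta>. is_bump C S \<delta> \<beta>" and C: "C > 0"
    and r: "\<And>x. r x > 0" and P: "\<And>n c x. C1_at (P n c) x"
  obtains h where "\<And>x. C1_at h x"
    "\<And>y q. \<exists>N w c. (\<forall>n. 0 \<le> w n \<and> dist (c n) y < r (c n)) \<and> (\<Sum>n<N. w n) = 1 \<and>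
      norm (fderiv h y - (\<Sum>n<N. w n *\<^sub>R fderiv (P n (c n)) y))
        \<le> (\<Sum>n<N. 12 * C * 2 ^ n * norm (P n (c n) y - q))"
proof -
  obtain T :: "nat \<Rightarrow> 'a \<Rightarrow> 'a set" where
    T_sub: "\<And>n c x z. x \<in> T n c \<Longrightarrow> dist x z < (1/2) ^ n \<Longrightarrow> dist c z < r c" and
    T_sep: "\<And>n c c' x y. x \<in> T n c \<Longrightarrow> y \<in> T n c' \<Longrightarrow> c \<noteq> c' \<Longrightarrow> (1/2) ^ n \<le> dist x y" and
    T_cover: "\<And>x. \<exists>n c. x \<in> T n c"
    by (rule sigma_discrete_refinement[OF r]) (rule that)
  define \<delta> where "\<delta> n = (1/2) ^ n / (4::real)" for n :: nat
  have \<delta>: "\<delta> n > 0" "\<delta> n < (1/2) ^ n" "2 * \<delta> n < (1/2) ^ n" for n by (auto simp: \<delta>_def)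
  define V where "V n c = {z. \<exists>t\<in>T n c. dist z t < \<delta> n}" for n c
  have openV: "open (V n c)" for n c
  proof -
    have "V n c = (\<Union>t\<in>T n c. ball t (\<delta> n))" by (auto simp: V_def dist_commute)
    then show ?thesis by auto
  qed
  have V_r: "dist c z < r c" if "z \<in> V n c" for n c z
    using that T_sub \<delta>(2)[of n] by (force simp: V_def dist_commute)
  have V_unique: "c = c'" if z: "z \<in> V n c" "z \<in> V n c'" for n c c' z
  proof (rule ccontr)
    assume ne: "c \<noteq> c'"
    obtain t t' where t: "t \<in> T n c" "dist z t < \<delta> n" "t' \<in> T n c'" "dist z t' < \<delta> n"
      using z unfolding V_def by blast
    then have "dist t t' < 2 * \<delta> n" using dist_triangle3[of t t' z] by linarith
    with T_sep[OF t(1,3) ne] \<delta>(3)[of n] show False by linarith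
  qed
  \<comment> \<open>an inactive level gets the dummy centre \<open>z\<close>, which is admissible since \<open>r z > 0\<close>\<close>
  define sel where "sel n z = (if \<exists>c. z \<in> V n c then (SOME c. z \<in> V n c) else z)" for n z
  have sel: "sel n z = c" if "z \<in> V n c" for n z c
  proof -
    have "(SOME c. z \<in> V n c) = c" by (rule V_unique[OF someI[of "\<lambda>c. z \<in> V n c", OF that] that])
    then show ?thesis using that by (auto simp: sel_def)
  qed
  have sel_r: "dist (sel n z) z < r (sel n z)" for n z
  proof (cases "\<exists>c. z \<in> V n c")
    case True
    then obtain c where "z \<in> V n c" by blast
    then show ?thesis using sel[of z n c] V_r[of z n c] by simp
  next
    case False
    then show ?thesis using r[of z] by (simp add: sel_def)
  qed
  have "\<forall>n. \<exists>b. is_bump C (\<Union>c. T n c) (\<delta> n) b" using bumps[OF \<delta>(1)] by simp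
  from choice[OF this] obtain \<beta> where \<beta>: "\<And>n. is_bump C (\<Union>c. T n c) (\<delta> n) (\<beta> n)"
    by auto
  have \<beta>C1: "C1_at (\<beta> n) x" and \<beta>01: "0 \<le> \<beta> n x" "\<beta> n x \<le> 1"
    and \<beta>D: "norm (fderiv (\<beta> n) x) \<le> 4 * C * 2 ^ n" for n x
    using \<beta>[of n] by (auto simp: is_bump_def \<delta>_def power_one_over field_simps)
  define \<pi> where "\<pi> n x = (\<Prod>m<n. 1 - \<beta> m x)" for n x
  have \<pi>_Suc: "\<pi> (Suc n) = (\<lambda>x. \<pi> n x *\<^sub>R (1 - \<beta> n x))" for n
    by (auto simp: \<pi>_def)
  have \<pi>01: "0 \<le> \<pi> n x" "\<pi> n x \<le> 1" for n x
    unfolding \<pi>_def using \<beta>01 by (auto intro!: prod_nonneg prod_le_1)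
  have \<pi>C1D: "C1_at (\<pi> n) x \<and> norm (fderiv (\<pi> n) x) \<le> 4 * C * 2 ^ n" for n x
  proof (induction n)
    case 0
    have "\<pi> 0 = (\<lambda>_. 1)" by (auto simp: \<pi>_def)
    then show ?case using C by simp
  next
    case (Suc n)
    have 1: "C1_at (\<lambda>x. 1 - \<beta> n x) x" by (intro C1_at_diff C1_at_const \<beta>C1)
    have 2: "fderiv (\<lambda>x. 1 - \<beta> n x) x = - fderiv (\<beta> n) x"
      by (subst fderiv_diff) (auto simp: \<beta>C1)
    have "norm (fderiv (\<pi> (Suc n)) x)
        = norm (\<pi> n x *\<^sub>R - fderiv (\<beta> n) x + outer (1 - \<beta> n x) (fderiv (\<pi> n) x))"
      unfolding \<pi>_Suc using Suc 1 by (subst fderiv_scaleR) (simp_all only: 2)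
    also have "\<dots> \<le> norm (\<pi> n x *\<^sub>R - fderiv (\<beta> n) x) + norm (outer (1 - \<beta> n x) (fderiv (\<pi> n) x))"
      by (rule norm_triangle_ineq)
    also have "\<dots> \<le> 1 * (4 * C * 2 ^ n) + (4 * C * 2 ^ n) * 1"
    proof (rule add_mono)
      show "norm (\<pi> n x *\<^sub>R - fderiv (\<beta> n) x) \<le> 1 * (4 * C * 2 ^ n)"
        unfolding norm_scaleR norm_minus_cancel using \<pi>01[of n x] \<beta>D[of n x] by (intro mult_mono) auto
      have "norm (outer (1 - \<beta> n x) (fderiv (\<pi> n) x)) \<le> norm (fderiv (\<pi> n) x) * norm (1 - \<beta> n x)"
        by (rule norm_outer_le)
      also have "\<dots> \<le> (4 * C * 2 ^ n) * 1"
        using Suc \<beta>01[of n x] C by (intro mult_mono) auto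
      finally show "norm (outer (1 - \<beta> n x) (fderiv (\<pi> n) x)) \<le> (4 * C * 2 ^ n) * 1" .
    qed
    finally have "norm (fderiv (\<pi> (Suc n)) x) \<le> 4 * C * 2 ^ Suc n" by simp
    moreover have "C1_at (\<pi> (Suc n)) x" unfolding \<pi>_Suc using Suc 1 by (intro C1_at_scaleR) auto
    ultimately show ?case by simp
  qed
  define \<phi> where "\<phi> n x = \<pi> n x - \<pi> (Suc n) x" for n x
  have \<phi>_eq: "\<phi> n x = \<pi> n x * \<beta> n x" for n x by (simp add: \<phi>_def \<pi>_Suc algebra_simps)
  have \<phi>_sum: "(\<Sum>n<N. \<phi> n x) = 1 - \<pi> N x" for N x
    using sum_lessThan_telescope'[of "\<lambda>n. \<pi> n x" N] by (simp add: \<phi>_def) (simp add: \<pi>_def)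
  have \<phi>C1: "C1_at (\<phi> n) x" for n x
    unfolding \<phi>_def[abs_def] using \<pi>C1D by (intro C1_at_diff) auto
  have \<phi>D: "norm (fderiv (\<phi> n) x) \<le> 12 * C * 2 ^ n" for n x
  proof -
    have "fderiv (\<phi> n) x = fderiv (\<pi> n) x - fderiv (\<pi> (Suc n)) x"
      unfolding \<phi>_def[abs_def] using \<pi>C1D by (intro fderiv_diff) auto
    then show ?thesis
      using norm_triangle_ineq4[of "fderiv (\<pi> n) x" "fderiv (\<pi> (Suc n)) x"] \<pi>C1D[of n x] \<pi>C1D[of "Suc n" x]
      by simp
  qed
  define Q where "Q n x = \<phi> n x *\<^sub>R P n (sel n x) x" for n x
  have Q: "C1_at (Q n) y \<and> fderiv (Q n) y = \<phi> n y *\<^sub>R fderiv (P n (sel n y)) y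
      + outer (P n (sel n y) y) (fderiv (\<phi> n) y)" for n y
  proof (cases "\<exists>c. y \<in> V n c")
    case True
    then obtain c where c: "y \<in> V n c" by blast
    have ev: "\<forall>\<^sub>F z in nhds y. \<phi> n z *\<^sub>R P n c z = Q n z"
      using eventually_nhds_in_open[OF openV c] by eventually_elim (simp add: Q_def sel)
    have C1: "C1_at (\<lambda>z. \<phi> n z *\<^sub>R P n c z) y" by (intro C1_at_scaleR \<phi>C1 P)
    show ?thesis
      using C1_at_transform[OF C1 ev] fderiv_transform[OF C1 ev] fderiv_scaleR[OF \<phi>C1 P] sel[OF c]
      by simp
  next
    case False
    then have "\<not> (\<exists>s\<in>(\<Union>c. T n c). dist y s < \<delta> n)" by (auto simp: V_def)
    then have ev: "\<forall>\<^sub>F z in nhds y. \<beta> n z = 0" by (rule is_bump_eventually_0[OF \<beta>])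
    then have ev1: "\<forall>\<^sub>F z in nhds y. 0 = \<phi> n z" and ev2: "\<forall>\<^sub>F z in nhds y. 0 = Q n z"
      by (auto elim!: eventually_mono simp: \<phi>_eq Q_def)
    show ?thesis
      using fderiv_transform[OF C1_at_const ev1] C1_at_transform[OF C1_at_const ev2]
        fderiv_transform[OF C1_at_const ev2] eventually_nhds_x_imp_x[OF ev1] by simp
  qed
  define h where "h x = (\<Sum>n. Q n x)" for x
  have loc: "\<exists>N. (\<forall>\<^sub>F z in nhds y. \<pi> N z = 0) \<and> (\<forall>\<^sub>F z in nhds y. (\<Sum>n<N. Q n z) = h z)" for y
  proof -
    obtain N c where "y \<in> T N c" using T_cover by blast
    then have "\<forall>\<^sub>F z in nhds y. \<beta> N z = 1" by (intro is_bump_eventually_1[OF \<beta>]) auto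
    then have ev: "\<forall>\<^sub>F z in nhds y. \<forall>n\<ge>Suc N. \<pi> n z = 0"
    proof eventually_elim
      case (elim z)
      then show ?case unfolding \<pi>_def by (auto intro!: bexI[of _ N])
    qed
    then have "\<forall>\<^sub>F z in nhds y. \<pi> (Suc N) z = 0" by eventually_elim auto
    moreover have "\<forall>\<^sub>F z in nhds y. (\<Sum>n<Suc N. Q n z) = h z"
      using ev
    proof eventually_elim
      case (elim z)
      then have "Q n z = 0" if "n \<ge> Suc N" for n using that by (simp add: Q_def \<phi>_eq)
      then show ?case unfolding h_def by (intro suminf_finite[symmetric]) auto
    qed
    ultimately show ?thesis by blast
  qed
  have C1_sum: "C1_at (\<lambda>z. \<Sum>n<N. Q n z) y" for N y using Q by (intro C1_at_sum) auto
  show thesis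
  proof
    show "C1_at h y" for y using loc[of y] C1_at_transform[OF C1_sum] by blast
    fix y q
    obtain N where N: "\<forall>\<^sub>F z in nhds y. \<pi> N z = 0" "\<forall>\<^sub>F z in nhds y. (\<Sum>n<N. Q n z) = h z"
      using loc by blast
    have "\<forall>\<^sub>F z in nhds y. 1 = (\<Sum>n<N. \<phi> n z)"
      using N(1) by eventually_elim (simp add: \<phi>_sum)
    from fderiv_transform[OF C1_at_const this] have D0: "(\<Sum>n<N. fderiv (\<phi> n) y) = 0"
      using \<phi>C1 by (simp add: fderiv_sum)
    have "fderiv h y = (\<Sum>n<N. fderiv (Q n) y)"
      using fderiv_transform[OF C1_sum N(2)] Q by (simp add: fderiv_sum)
    also have "\<dots> = (\<Sum>n<N. \<phi> n y *\<^sub>R fderiv (P n (sel n y)) y)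
        + (\<Sum>n<N. outer (P n (sel n y) y) (fderiv (\<phi> n) y))"
      using Q by (simp add: sum.distrib)
    \<comment> \<open>the derivatives of the weights sum to zero, so any fixed vector may be subtracted\<close>
    also have "(\<Sum>n<N. outer (P n (sel n y) y) (fderiv (\<phi> n) y))
        = (\<Sum>n<N. outer (P n (sel n y) y - q) (fderiv (\<phi> n) y))"
      by (simp add: outer_diff_left sum_subtractf flip: outer_sum_right) (simp add: D0)
    finally have "norm (fderiv h y - (\<Sum>n<N. \<phi> n y *\<^sub>R fderiv (P n (sel n y)) y))
        = norm (\<Sum>n<N. outer (P n (sel n y) y - q) (fderiv (\<phi> n) y))" by simp
    also have "\<dots> \<le> (\<Sum>n<N. 12 * C * 2 ^ n * norm (P n (sel n y) y - q))"
    proof (rule sum_norm_le)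
      fix n
      show "norm (outer (P n (sel n y) y - q) (fderiv (\<phi> n) y)) \<le> 12 * C * 2 ^ n * norm (P n (sel n y) y - q)"
        using norm_outer_le[of "P n (sel n y) y - q" "fderiv (\<phi> n) y"]
          mult_right_mono[OF \<phi>D[of n y] norm_ge_zero[of "P n (sel n y) y - q"]] by linarith
    qed
    finally have "norm (fderiv h y - (\<Sum>n<N. \<phi> n y *\<^sub>R fderiv (P n (sel n y)) y))
        \<le> (\<Sum>n<N. 12 * C * 2 ^ n * norm (P n (sel n y) y - q))" .
    moreover have "(\<Sum>n<N. \<phi> n y) = 1"
      using eventually_nhds_x_imp_x[OF N(1)] by (simp add: \<phi>_sum)
    moreover have "0 \<le> \<phi> n y" for n using \<pi>01 \<beta>01 by (simp add: \<phi>_eq)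
    ultimately show "\<exists>N w c. (\<forall>n. 0 \<le> w n \<and> dist (c n) y < r (c n)) \<and> (\<Sum>n<N. w n) = 1 \<and>
      norm (fderiv h y - (\<Sum>n<N. w n *\<^sub>R fderiv (P n (c n)) y))
        \<le> (\<Sum>n<N. 12 * C * 2 ^ n * norm (P n (c n) y - q))"
      using sel_r by (intro exI[of _ N] exI[of _ "\<lambda>n. \<phi> n y"] exI[of _ "\<lambda>n. sel n y"]) auto
  qed
qed

section \<open>Approximation on a subspace together with the derivative\<close>

lemma norm_convex_combination_diff_le:
  fixes u :: "'i \<Rightarrow> 'b::real_normed_vector"
  assumes w: "\<And>i. i \<in> I \<Longrightarrow> 0 \<le> w i" "(\<Sum>i\<in>I. w i) = 1"
    and K: "\<And>i. i \<in> I \<Longrightarrow> norm (u i - c) \<le> K"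
  shows "norm ((\<Sum>i\<in>I. w i *\<^sub>R u i) - c) \<le> K"
proof -
  have "(\<Sum>i\<in>I. w i *\<^sub>R u i) - c = (\<Sum>i\<in>I. w i *\<^sub>R (u i - c))"
    using w(2) by (simp add: scaleR_diff_right sum_subtractf flip: scaleR_sum_left)
  also have "norm \<dots> \<le> (\<Sum>i\<in>I. w i * K)"
  proof (rule sum_norm_le)
    fix i assume "i \<in> I"
    then show "norm (w i *\<^sub>R (u i - c)) \<le> w i * K"
      using w(1)[of i] K[of i] by (simp add: mult_left_mono)
  qed
  also have "\<dots> = K" using w(2) by (simp flip: sum_distrib_right)
  finally show ?thesis .
qed

text \<open>
  The local maps are Taylor maps of \<open>f\<close> plus smooth approximations of the remainders. Their
  derivatives satisfy two convex conditions, closeness to \<open>f' y\<close> along \<open>Y\<close> and a bound on the full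
  operator norm, so both pass to the glued map up to a small error. The second one is what a global Lipschitz bound needs:
  being close to \<open>f'\<close> along \<open>Y\<close> says nothing about directions transversal to \<open>Y\<close>.
\<close>

lemma C1_approximation_with_derivative:
  fixes f :: "'a::real_normed_vector \<Rightarrow> 'b::real_normed_vector"
  assumes approx: "C1_approximable TYPE('a) TYPE('b) C0"
    and bumps: "\<And>(S::'a set) \<delta>. \<delta> > 0 \<Longrightarrow> \<exists>\<beta>. is_bump C S \<delta> \<beta>" and C: "C > 0"
    and Y: "subspace Y" "closed Y"
    and l: "l \<ge> 0" and ext: "\<And>T. bounded_linear_on Y T \<Longrightarrow>
      \<exists>T'::'a \<Rightarrow>\<^sub>L 'b. (\<forall>y\<in>Y. blinfun_apply T' y = T y) \<and> norm T' \<le> l * onorm_on Y T"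
    and f: "C1_deriv_on Y f f'" and \<epsilon>: "\<epsilon> > 0"
  obtains h where "\<And>x. C1_at h x"
    "\<And>y v. y \<in> Y \<Longrightarrow> v \<in> Y \<Longrightarrow> norm (f' y v - fderiv h y v) \<le> \<epsilon> * norm v"
    "\<And>L y. 0 \<le> L \<Longrightarrow> \<forall>y\<in>Y. \<forall>v\<in>Y. norm (f' y v) \<le> L * norm v \<Longrightarrow> y \<in> Y \<Longrightarrow>
      norm (fderiv h y) \<le> l * L + \<epsilon>"
proof -
  have C0: "C0 \<ge> 1" using approx by (simp add: C1_approximable_def)
  define e where "e = \<epsilon> / (3 * C0)"
  have e: "e > 0" "C0 * e = \<epsilon> / 3" "e \<le> \<epsilon> / 3"
    using \<epsilon> C0 by (auto simp: e_def field_simps)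
  \<comment> \<open>the accuracy at level \<open>n\<close>: multiplied by the slope \<open>12 * C * 2 ^ n\<close> it sums to at most \<open>\<epsilon> / 3\<close>\<close>
  define \<delta> where "\<delta> n = \<epsilon> / (72 * C * 4 ^ n)" for n :: nat
  have \<delta>: "\<delta> n > 0" for n using \<epsilon> C by (simp add: \<delta>_def)
  have Y0: "Y \<noteq> {}" using subspace_0[OF Y(1)] by blast
  \<comment> \<open>balls around points outside \<open>Y\<close> avoid \<open>Y\<close>, so at points of \<open>Y\<close> only centres in \<open>Y\<close> are active\<close>
  have "\<forall>x. \<exists>\<rho>>0. (x \<notin> Y \<longrightarrow> (\<forall>y\<in>Y. \<not> dist x y < \<rho>)) \<and>
      (x \<in> Y \<longrightarrow> (\<forall>y\<in>Y. dist x y < \<rho> \<longrightarrow> (\<forall>v\<in>Y. norm (f' y v - f' x v) \<le> e * norm v)))"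
  proof
    fix x
    show "\<exists>\<rho>>0. (x \<notin> Y \<longrightarrow> (\<forall>y\<in>Y. \<not> dist x y < \<rho>)) \<and>
      (x \<in> Y \<longrightarrow> (\<forall>y\<in>Y. dist x y < \<rho> \<longrightarrow> (\<forall>v\<in>Y. norm (f' y v - f' x v) \<le> e * norm v)))"
    proof (cases "x \<in> Y")
      case True
      obtain d where "d > 0" "\<And>y v. y \<in> Y \<Longrightarrow> norm (y - x) < d \<Longrightarrow> v \<in> Y \<Longrightarrow> norm (f' y v - f' x v) \<le> e * norm v"
        by (rule C1_deriv_on_continuous[OF f True e(1)]) (rule that)
      then show ?thesis using True by (intro exI[of _ d]) (auto simp: dist_norm norm_minus_commute)
    next
      case False
      then have "infdist x Y > 0" using infdist_pos_not_in_closed[OF Y(2) Y0] by simp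
      then show ?thesis using False infdist_le[of _ Y x]
        by (intro exI[of _ "infdist x Y"]) (auto simp: not_less)
    qed
  qed
  from choice[OF this] obtain \<rho> where \<rho>_all: "\<forall>x. \<rho> x > 0 \<and> (x \<notin> Y \<longrightarrow> (\<forall>y\<in>Y. \<not> dist x y < \<rho> x)) \<and>
      (x \<in> Y \<longrightarrow> (\<forall>y\<in>Y. dist x y < \<rho> x \<longrightarrow> (\<forall>v\<in>Y. norm (f' y v - f' x v) \<le> e * norm v)))" ..
  then have \<rho>: "\<rho> x > 0" "x \<notin> Y \<Longrightarrow> y \<in> Y \<Longrightarrow> \<not> dist x y < \<rho> x"
    "x \<in> Y \<Longrightarrow> y \<in> Y \<Longrightarrow> dist x y < \<rho> x \<Longrightarrow> v \<in> Y \<Longrightarrow> norm (f' y v - f' x v) \<le> e * norm v"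
    for x y v by auto
  define good where "good n y D p \<longleftrightarrow> norm (p - f y) \<le> \<delta> n \<and>
      (\<forall>v\<in>Y. norm (blinfun_apply D v - f' y v) \<le> 2 * \<epsilon> / 3 * norm v) \<and>
      (\<forall>L\<ge>0. (\<forall>y\<in>Y. \<forall>v\<in>Y. norm (f' y v) \<le> L * norm v) \<longrightarrow> norm D \<le> l * L + \<epsilon> / 3)"
    for n y p and D :: "'a \<Rightarrow>\<^sub>L 'b"
  have local: "\<exists>p. (\<forall>z. C1_at p z) \<and> (x \<in> Y \<longrightarrow> (\<forall>y\<in>Y. dist x y < \<rho> x \<longrightarrow> good n y (fderiv p y) (p y)))" for n x
  proof (cases "x \<in> Y")
    case False
    then show ?thesis by (intro exI[of _ "\<lambda>_. 0"]) simp
  next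
    case x: True
    have blx: "bounded_linear_on Y (f' x)" by (rule C1_deriv_on_linear[OF f x])
    obtain T :: "'a \<Rightarrow>\<^sub>L 'b" where T: "\<And>y. y \<in> Y \<Longrightarrow> T y = f' x y" "norm T \<le> l * onorm_on Y (f' x)"
      using ext[OF blx] by auto
    define a where "a z = f x + T (z - x)" for z
    have a: "C1_at a z" "fderiv a z = T" for z
      unfolding a_def[abs_def] by (rule C1_at_affine fderiv_affine)+
    have fa: "C1_deriv_on Y (\<lambda>z. f z - a z) (\<lambda>z v. f' z v - T v)"
      using C1_deriv_on_diff[OF f C1_deriv_on_fderiv[OF a(1)]] by (simp add: a(2))
    have "e-lipschitz_on (Y \<inter> ball x (\<rho> x)) (\<lambda>z. f z - a z)"
    proof (rule lipschitz_on_of_C1_deriv_on_bound[OF Y(1) _ _ fa])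
      show "convex (Y \<inter> ball x (\<rho> x))"
        by (intro convex_Int subspace_imp_convex Y convex_ball)
      fix z v assume "z \<in> Y \<inter> ball x (\<rho> x)" "v \<in> Y"
      then show "norm (f' z v - T v) \<le> e * norm v" using \<rho>(3)[OF x, of z v] T(1) by simp
    qed (use e in auto)
    then obtain g where g: "\<And>z. C1_at g z" "\<And>z. norm (fderiv g z) \<le> C0 * e"
      "\<And>z. z \<in> Y \<inter> ball x (\<rho> x) \<Longrightarrow> norm (f z - a z - g z) < \<delta> n"
      by (rule C1_approximableE[OF approx _ \<delta>]) (rule that)
    define p where "p z = a z + g z" for z
    have p: "C1_at p z" "fderiv p z = T + fderiv g z" for z
      unfolding p_def[abs_def] using a g(1) by (simp_all add: C1_at_add fderiv_add)
    have "good n y (fderiv p y) (p y)" if y: "y \<in> Y" "dist x y < \<rho> x" for y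
      unfolding good_def
    proof (intro conjI ballI allI impI)
      show "norm (p y - f y) \<le> \<delta> n"
        using g(3)[of y] y norm_minus_commute[of "p y" "f y"] by (simp add: p_def algebra_simps)
      fix v assume v: "v \<in> Y"
      have "norm (fderiv p y v - f' y v) = norm (fderiv g y v - (f' y v - f' x v))"
        using T(1)[OF v] by (simp add: p(2) blinfun.add_left algebra_simps)
      also have "\<dots> \<le> norm (fderiv g y v) + norm (f' y v - f' x v)" by (rule norm_triangle_ineq4)
      also have "norm (fderiv g y v) \<le> \<epsilon> / 3 * norm v"
        using norm_blinfun[of "fderiv g y" v] mult_right_mono[OF g(2)[of y] norm_ge_zero[of v]] e(2)
        by simp
      also have "norm (f' y v - f' x v) \<le> \<epsilon> / 3 * norm v"
        using \<rho>(3)[OF x y v] mult_right_mono[OF e(3) norm_ge_zero[of v]] by linarith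
      finally show "norm (fderiv p y v - f' y v) \<le> 2 * \<epsilon> / 3 * norm v" by simp
    next
      fix L :: real assume L: "0 \<le> L" "\<forall>y\<in>Y. \<forall>v\<in>Y. norm (f' y v) \<le> L * norm v"
      have "onorm_on Y (f' x) \<le> L" using L x by (intro onorm_on_le Y0) auto
      then have "norm T \<le> l * L" using T(2) mult_left_mono[of _ L l] l by (meson order_trans)
      moreover have "norm (fderiv g y) \<le> \<epsilon> / 3" using g(2)[of y] e(2) by simp
      ultimately show "norm (fderiv p y) \<le> l * L + \<epsilon> / 3"
        using norm_triangle_ineq[of T "fderiv g y"] by (simp add: p(2))
    qed
    then show ?thesis using p(1) by blast
  qed
  then have "\<forall>nx. \<exists>p. (\<forall>z. C1_at p z) \<and> (snd nx \<in> Y \<longrightarrow>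
      (\<forall>y\<in>Y. dist (snd nx) y < \<rho> (snd nx) \<longrightarrow> good (fst nx) y (fderiv p y) (p y)))" by blast
  from choice[OF this] obtain P0 where P0: "\<forall>nx. (\<forall>z. C1_at (P0 nx) z) \<and> (snd nx \<in> Y \<longrightarrow>
      (\<forall>y\<in>Y. dist (snd nx) y < \<rho> (snd nx) \<longrightarrow> good (fst nx) y (fderiv (P0 nx) y) (P0 nx y)))" ..
  define P where "P n x = P0 (n, x)" for n x
  have P: "C1_at (P n x) z" for n x z using P0 by (simp add: P_def)
  have good: "good n y (fderiv (P n x) y) (P n x y)" if "y \<in> Y" "dist x y < \<rho> x" for n x y
  proof -
    have "x \<in> Y" using \<rho>(2)[of x y] that by blast
    then show ?thesis using P0[THEN spec, of "(n, x)"] that by (simp add: P_def)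
  qed
  obtain h where h: "\<And>x. C1_at h x"
    "\<And>y q. \<exists>N w c. (\<forall>n. 0 \<le> w n \<and> dist (c n) y < \<rho> (c n)) \<and> (\<Sum>n<N. w n) = 1 \<and>
      norm (fderiv h y - (\<Sum>n<N. w n *\<^sub>R fderiv (P n (c n)) y))
        \<le> (\<Sum>n<N. 12 * C * 2 ^ n * norm (P n (c n) y - q))"
    by (rule glue_local_C1_maps[of C \<rho> P, OF bumps C \<rho>(1) P]) (assumption | rule that)+
  have key: "\<exists>N w D. (\<forall>n. 0 \<le> w n \<and> (\<exists>p. good n y (D n) p)) \<and> (\<Sum>n<N. w n) = (1::real) \<and>
      norm (fderiv h y - (\<Sum>n<N. w n *\<^sub>R D n)) \<le> \<epsilon> / 3" if y: "y \<in> Y" for y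
  proof -
    obtain N w c where wc: "\<forall>n. 0 \<le> w n \<and> dist (c n) y < \<rho> (c n)" "(\<Sum>n<N. w n) = 1"
      "norm (fderiv h y - (\<Sum>n<N. w n *\<^sub>R fderiv (P n (c n)) y))
        \<le> (\<Sum>n<N. 12 * C * 2 ^ n * norm (P n (c n) y - f y))"
      using h(2)[of y "f y"] by auto
    have g: "good n y (fderiv (P n (c n)) y) (P n (c n) y)" for n using good[OF y] wc(1) by blast
    have "(\<Sum>n<N. 12 * C * 2 ^ n * norm (P n (c n) y - f y)) \<le> (\<Sum>n<N. \<epsilon> / 6 * (1/2) ^ n)"
    proof (rule sum_mono)
      fix n
      have "12 * C * 2 ^ n * norm (P n (c n) y - f y) \<le> 12 * C * 2 ^ n * \<delta> n"
        using g[of n] C by (intro mult_left_mono) (auto simp: good_def)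
      also have "\<dots> = \<epsilon> / 6 * (1/2) ^ n"
        using C by (simp add: \<delta>_def field_simps flip: power_mult_distrib)
      finally show "12 * C * 2 ^ n * norm (P n (c n) y - f y) \<le> \<epsilon> / 6 * (1/2) ^ n" .
    qed
    also have "\<dots> = \<epsilon> / 6 * (\<Sum>n<N. (1/2) ^ n)" by (simp add: sum_distrib_left)
    also have "\<dots> \<le> \<epsilon> / 6 * 2"
      using \<epsilon> by (intro mult_left_mono) (auto simp: geometric_sum)
    finally have "norm (fderiv h y - (\<Sum>n<N. w n *\<^sub>R fderiv (P n (c n)) y)) \<le> \<epsilon> / 3"
      using wc(3) by simp
    then show ?thesis using wc(1,2) g
      by (intro exI[of _ N] exI[of _ w] exI[of _ "\<lambda>n. fderiv (P n (c n)) y"]) auto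
  qed
  show thesis
  proof
    show "C1_at h x" for x by (rule h)
  next
    fix y v assume y: "y \<in> Y" and v: "v \<in> Y"
    obtain N w D where D: "\<forall>n. 0 \<le> w n \<and> (\<exists>p. good n y (D n) p)" "(\<Sum>n<N. w n) = (1::real)"
      "norm (fderiv h y - (\<Sum>n<N. w n *\<^sub>R D n)) \<le> \<epsilon> / 3"
      using key[OF y] by auto
    have "norm ((\<Sum>n<N. w n *\<^sub>R D n v) - f' y v) \<le> 2 * \<epsilon> / 3 * norm v"
      using D(1,2) v by (intro norm_convex_combination_diff_le) (auto simp: good_def)
    moreover have "norm (fderiv h y v - (\<Sum>n<N. w n *\<^sub>R D n v)) \<le> \<epsilon> / 3 * norm v"
      using norm_blinfun[of "fderiv h y - (\<Sum>n<N. w n *\<^sub>R D n)" v] mult_right_mono[OF D(3) norm_ge_zero[of v]]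
      by (simp add: blinfun.bilinear_simps)
    ultimately show "norm (f' y v - fderiv h y v) \<le> \<epsilon> * norm v"
      using norm_triangle_ineq[of "fderiv h y v - (\<Sum>n<N. w n *\<^sub>R D n v)" "(\<Sum>n<N. w n *\<^sub>R D n v) - f' y v"]
      by (simp add: norm_minus_commute)
  next
    fix L y assume L: "0 \<le> L" "\<forall>y\<in>Y. \<forall>v\<in>Y. norm (f' y v) \<le> L * norm v" and y: "y \<in> Y"
    obtain N w D where D: "\<forall>n. 0 \<le> w n \<and> (\<exists>p. good n y (D n) p)" "(\<Sum>n<N. w n) = (1::real)"
      "norm (fderiv h y - (\<Sum>n<N. w n *\<^sub>R D n)) \<le> \<epsilon> / 3"
      using key[OF y] by auto
    have "norm (D n) \<le> l * L + \<epsilon> / 3" for n using D(1) L unfolding good_def by meson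
    then have "norm ((\<Sum>n<N. w n *\<^sub>R D n) - 0) \<le> l * L + \<epsilon> / 3"
      using D(1,2) by (intro norm_convex_combination_diff_le) auto
    then show "norm (fderiv h y) \<le> l * L + \<epsilon>"
      using D(3) norm_triangle_ineq[of "fderiv h y - (\<Sum>n<N. w n *\<^sub>R D n)" "\<Sum>n<N. w n *\<^sub>R D n"] \<epsilon>
      by simp
  qed
qed

section \<open>Bounding the derivative off the subspace\<close>

lemma locally_stabilizing_limit:
  fixes H :: "nat \<Rightarrow> 'a::topological_space \<Rightarrow> 'b::t2_space"
  assumes "\<And>x. \<exists>N. \<forall>\<^sub>F z in nhds x. \<forall>n\<ge>N. H n z = H N z"
  shows "\<exists>N. \<forall>\<^sub>F z in nhds x. H N z = lim (\<lambda>n. H n z)"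
proof -
  obtain N where "\<forall>\<^sub>F z in nhds x. \<forall>n\<ge>N. H n z = H N z" using assms by blast
  then have "\<forall>\<^sub>F z in nhds x. H N z = lim (\<lambda>n. H n z)"
  proof eventually_elim
    case (elim z)
    then have "(\<lambda>n. H n z) \<longlonglongrightarrow> H N z"
      by (intro tendsto_eventually eventually_sequentiallyI[of N]) blast
    then show ?case by (simp add: limI)
  qed
  then show ?thesis by blast
qed

lemma infdist_lessE:
  assumes "infdist x Y < e" "Y \<noteq> {}"
  obtains y where "y \<in> Y" "dist x y < e"
  using assms(1) unfolding infdist_notempty[OF assms(2)]
  by (subst (asm) cINF_less_iff) (auto simp: assms intro: that)

text \<open>
  Together with the formula in \<open>fderiv_interpolation\<close> for the derivative of \<open>f + b (g - f)\<close>, this bounds the derivative of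
  a blend of two maps; \<open>E\<close> stands for the term in which the cut-off function \<open>b\<close> is differentiated.
\<close>

lemma norm_interpolation_le:
  fixes D0 D1 E :: "'a::real_normed_vector"
  assumes "norm D0 \<le> A" "norm D1 \<le> B" "0 \<le> b" "b \<le> 1" "norm E \<le> K"
  shows "norm (D0 + (b *\<^sub>R (D1 - D0) + E)) \<le> 2 * A + B + K"
proof -
  have "norm (b *\<^sub>R (D1 - D0)) \<le> norm (D1 - D0)"
    using assms(3,4) by (simp add: mult_left_le_one_le)
  then show ?thesis
    using norm_triangle_ineq[of D0 "b *\<^sub>R (D1 - D0) + E"] norm_triangle_ineq[of "b *\<^sub>R (D1 - D0)" E]
      norm_triangle_ineq4[of D1 D0] assms by linarith
qed

lemma norm_six_terms_le:
  fixes a b c d e f :: "'a::real_normed_vector"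
  shows "norm (a + b + c + d - e - f) \<le> norm a + norm b + norm c + norm d + norm e + norm f"
  using norm_triangle_ineq4[of "a + b + c + d - e" f] norm_triangle_ineq4[of "a + b + c + d" e]
    norm_triangle_ineq[of "a + b + c" d] norm_triangle_ineq[of "a + b" c] norm_triangle_ineq[of a b]
  by linarith

lemma fderiv_interpolation:
  assumes "C1_at f x" "C1_at g x" "C1_at b x"
  shows "C1_at (\<lambda>x. f x + b x *\<^sub>R (g x - f x)) x"
    "fderiv (\<lambda>x. f x + b x *\<^sub>R (g x - f x)) x =
      fderiv f x + (b x *\<^sub>R (fderiv g x - fderiv f x) + outer (g x - f x) (fderiv b x))"
  using assms by (simp_all add: C1_at_add C1_at_diff C1_at_scaleR fderiv_add fderiv_diff fderiv_scaleR)

text \<open>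
  Let \<open>d\<close> be the distance to \<open>Y\<close> and \<open>q n = 4\<^sup>-\<^sup>n\<close>. The map \<open>S n\<close> has a controlled derivative where
  \<open>d < 4 * q n\<close>: for \<open>n > 0\<close> it equals \<open>h\<close> at the points around which the ball of radius \<open>5 * q n\<close> lies
  in \<open>U\<close>, and it passes over to an approximation \<open>F n\<close> of \<open>h\<close> at a distance \<open>q n\<close> from these points.
  In the blending region there is a point of \<open>Y\<close> near by that can be joined to the given point inside
  \<open>U\<close>, so that \<open>h\<close> and \<open>F n\<close> differ by \<open>O(q n * M)\<close>, while the slope of the cut-off is \<open>O(1 / q n)\<close>.

  The maps \<open>H n\<close> switch from \<open>S n\<close> to \<open>S (n + 1)\<close> inside \<open>d < q n\<close>, where the two differ by
  \<open>O(q n * M)\<close> for the same reason. As \<open>H n\<close> is still equal to \<open>S n\<close> in that region, the error does not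
  accumulate and the derivative bound is the same for all \<open>n\<close>. The sequence is locally eventually
  constant: away from \<open>Y\<close> since the switches only happen close to \<open>Y\<close>, and near a point of
  \<open>Y\<close> since \<open>S n = h\<close> there for large \<open>n\<close>.
\<close>

lemma lipschitz_modification_off_subspace:
  fixes h :: "'a::real_normed_vector \<Rightarrow> 'b::real_normed_vector"
  assumes approx: "C1_approximable TYPE('a) TYPE('b) C0"
    and bumps: "\<And>(S::'a set) \<delta>. \<delta> > 0 \<Longrightarrow> \<exists>\<beta>. is_bump C S \<delta> \<beta>" and C: "C > 0"
    and Y: "subspace Y" "closed Y" and h: "\<And>x. C1_at h x"
    and M: "M > 0" "\<And>y. y \<in> Y \<Longrightarrow> norm (fderiv h y) < M"
  obtains H where "\<And>x. C1_at H x" "\<And>y. y \<in> Y \<Longrightarrow> H y = h y"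
    "\<And>x. norm (fderiv H x) \<le> (9 * C0 + 59 * C0 * C) * M"
proof -
  have C0: "C0 \<ge> 1" using approx by (simp add: C1_approximable_def)
  have MC0: "M \<le> C0 * M" using C0 M(1) by simp
  have Y0: "Y \<noteq> {}" using subspace_0[OF Y(1)] by blast
  define q :: "nat \<Rightarrow> real" where "q n = (1/4) ^ n" for n
  have q: "q n > 0" "q (Suc n) = q n / 4" for n by (auto simp: q_def)
  have q_mono: "q n \<le> q m" if "m \<le> n" for m n
    unfolding q_def using that by (intro power_decreasing) auto
  have q_small: "\<exists>n. q n < e" if "e > 0" for e
    using real_arch_pow_inv[of e "1/4"] that by (auto simp: q_def)
  define d where "d x = infdist x Y" for x
  have open_d: "open {x. d x < c}" "open {x. c < d x}" for c
    unfolding d_def by (intro open_Collect_less continuous_intros)+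
  have near: "\<exists>y\<in>Y. dist x y < c" if "d x < c" for x c
    using that infdist_lessE[OF _ Y0] unfolding d_def by metis
  define U where "U = {x. norm (fderiv h x) < M}"
  have "continuous_on UNIV (fderiv h)"
    using h by (simp add: C1_at_def continuous_on_eq_continuous_at)
  then have openU: "open U" unfolding U_def by (intro open_Collect_less continuous_intros)
  have YU: "Y \<subseteq> U" using M by (auto simp: U_def)
  have h_diff: "h differentiable (at x)" for x
    using C1_at_has_derivative[OF h] by (auto simp: differentiable_def)
  have h_lip: "norm (h x - h y) \<le> M * dist x y" if "convex W" "W \<subseteq> U" "x \<in> W" "y \<in> W" for W x y
  proof -
    have "M-lipschitz_on W h"
    proof (rule lipschitz_on_of_norm_fderiv_le[OF that(1) h_diff])
      fix x assume "x \<in> W"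
      then have "x \<in> U" using that(2) by blast
      then show "norm (fderiv h x) \<le> M" by (simp add: U_def)
    qed (use M(1) in simp)
    from lipschitz_onD[OF this that(3,4)] show ?thesis by (simp add: dist_norm)
  qed
  have hY: "M-lipschitz_on Y h"
    using h_lip[OF subspace_imp_convex[OF Y(1)] YU] M(1) by (intro lipschitz_onI) (auto simp: dist_norm)
  \<comment> \<open>approximations of \<open>h\<close> on \<open>Y\<close>, the \<open>n\<close>-th one to be used at distance about \<open>q n\<close> from \<open>Y\<close>\<close>
  have "\<forall>n. \<exists>F. (\<forall>x. C1_at F x \<and> norm (fderiv F x) \<le> C0 * M) \<and> (\<forall>x\<in>Y. norm (h x - F x) < M * q n)"
  proof
    fix n
    have "M * q n > 0" using M(1) q(1) by simp
    then obtain F where "\<And>x. C1_at F x" "\<And>x. norm (fderiv F x) \<le> C0 * M"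
      "\<And>x. x \<in> Y \<Longrightarrow> norm (h x - F x) < M * q n"
      by (rule C1_approximableE[OF approx hY]) (rule that)
    then show "\<exists>F. (\<forall>x. C1_at F x \<and> norm (fderiv F x) \<le> C0 * M) \<and> (\<forall>x\<in>Y. norm (h x - F x) < M * q n)"
      by blast
  qed
  from choice[OF this] obtain F where F_all: "\<forall>n. (\<forall>x. C1_at (F n) x \<and> norm (fderiv (F n) x) \<le> C0 * M) \<and>
      (\<forall>x\<in>Y. norm (h x - F n x) < M * q n)" ..
  then have F: "C1_at (F n) x" "norm (fderiv (F n) x) \<le> C0 * M" "y \<in> Y \<Longrightarrow> norm (h y - F n y) < M * q n"
    for n x y by auto
  have F_lip: "norm (F n x - F n y) \<le> C0 * M * dist x y" for n x y
  proof -
    have "F n differentiable (at x)" for x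
      using C1_at_has_derivative[OF F(1)] by (auto simp: differentiable_def)
    then have "(C0 * M)-lipschitz_on UNIV (F n)"
      using F(2) C0 M(1) by (intro lipschitz_on_of_norm_fderiv_le) auto
    from lipschitz_onD[OF this, of x y] show ?thesis by (simp add: dist_norm)
  qed
  define V where "V n = {x. ball x (5 * q n) \<subseteq> U}" for n
  have "\<forall>n. \<exists>b. is_bump C (V n) (q n) b" using bumps[OF q(1)] by simp
  from choice[OF this] obtain b0 where b0: "\<forall>n. is_bump C (V n) (q n) (b0 n)" ..
  \<comment> \<open>the coarsest stage is \<open>F 0\<close> alone, since there is no bound on \<open>h - F 0\<close> far from \<open>Y\<close>\<close>
  define b where "b n = (if n = 0 then (\<lambda>_. 0) else b0 n)" for n :: nat
  have b: "C1_at (b n) x" "0 \<le> b n x" "b n x \<le> 1" "norm (fderiv (b n) x) \<le> C / q n" for n x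
    using b0 C q(1)[of n] by (auto simp: b_def is_bump_def)
  have b_far: "\<forall>\<^sub>F z in nhds x. b n z = 0" if "\<not> (\<exists>s\<in>V n. dist x s < q n)" for n x
    using is_bump_eventually_0[OF b0[THEN spec, of n] that] by (auto simp: b_def)
  have b_1: "b n x = 1" if "x \<in> V n" "n \<noteq> 0" for n x
    using eventually_nhds_x_imp_x[OF is_bump_eventually_1[OF b0[THEN spec, of n] that(1)]] that(2)
    by (simp add: b_def)
  define S where "S n x = F n x + b n x *\<^sub>R (h x - F n x)" for n x
  have S_C1: "C1_at (S n) x" and
    S_D: "fderiv (S n) x = fderiv (F n) x +
      (b n x *\<^sub>R (fderiv h x - fderiv (F n) x) + outer (h x - F n x) (fderiv (b n) x))" for n x
    unfolding S_def[abs_def] by (intro fderiv_interpolation F h b)+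
  have inU: "norm (fderiv h x) \<le> M \<and> norm (h x - F n x) \<le> 9 * C0 * M * q n"
    if x: "d x < 4 * q n" and s: "s \<in> V n" "dist x s < q n" for n x s
  proof -
    have "ball x (4 * q n) \<subseteq> ball s (5 * q n)"
    proof
      fix z assume "z \<in> ball x (4 * q n)"
      then show "z \<in> ball s (5 * q n)" using dist_triangle[of s z x] s(2) by (simp add: dist_commute)
    qed
    then have sub: "ball x (4 * q n) \<subseteq> U" using s(1) by (auto simp: V_def)
    have xb: "x \<in> ball x (4 * q n)" using q(1)[of n] by simp
    obtain y where y: "y \<in> Y" "dist x y < 4 * q n" using near[OF x] by blast
    have "norm (h x - h y) \<le> M * dist x y"
      using y by (intro h_lip[OF convex_ball sub xb]) simp
    also have "\<dots> \<le> C0 * M * (4 * q n)" using y(2) MC0 M(1) C0 by (intro mult_mono) auto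
    finally have 1: "norm (h x - h y) \<le> C0 * M * (4 * q n)" .
    have "norm (F n x - F n y) \<le> C0 * M * dist x y" by (rule F_lip)
    also have "\<dots> \<le> C0 * M * (4 * q n)" using y(2) M(1) C0 by (intro mult_left_mono) auto
    finally have 2: "norm (F n x - F n y) \<le> C0 * M * (4 * q n)" .
    have "M * q n \<le> C0 * M * q n" using MC0 q(1)[of n] by (intro mult_right_mono) auto
    then have 3: "norm (h y - F n y) \<le> C0 * M * q n" using F(3)[OF y(1), of n] by linarith
    have "norm (h x - F n x) = norm ((h x - h y) + (h y - F n y) - (F n x - F n y))" by simp
    also have "\<dots> \<le> norm (h x - h y) + norm (h y - F n y) + norm (F n x - F n y)"
      using norm_triangle_ineq4[of "(h x - h y) + (h y - F n y)" "F n x - F n y"]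
        norm_triangle_ineq[of "h x - h y" "h y - F n y"] by linarith
    finally have "norm (h x - F n x) \<le> norm (h x - h y) + norm (h y - F n y) + norm (F n x - F n y)" .
    with 1 2 3 have "norm (h x - F n x) \<le> 9 * C0 * M * q n" by linarith
    moreover have "x \<in> U" using sub xb by blast
    ultimately show ?thesis by (simp add: U_def)
  qed
  define K1 where "K1 = (3 * C0 + 9 * C0 * C) * M"
  have K1: "C0 * M \<le> K1" using C0 C M(1) by (simp add: K1_def mult_right_mono add_increasing2)
  have S_bounds: "norm (S n x - F n x) \<le> 9 * C0 * M * q n \<and> norm (fderiv (S n) x) \<le> K1"
    if x: "d x < 4 * q n" for n x
  proof (cases "\<exists>s\<in>V n. dist x s < q n")
    case True
    then obtain s where s: "s \<in> V n" "dist x s < q n" by blast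
    note u = inU[OF x s]
    have "norm (S n x - F n x) \<le> norm (h x - F n x)"
      unfolding S_def using b(2,3)[of n x] by (simp add: mult_left_le_one_le)
    then have "norm (S n x - F n x) \<le> 9 * C0 * M * q n" using u by linarith
    moreover have "norm (fderiv (S n) x) \<le> 2 * (C0 * M) + M + C / q n * (9 * C0 * M * q n)"
      unfolding S_D
    proof (rule norm_interpolation_le)
      have "norm (outer (h x - F n x) (fderiv (b n) x)) \<le> norm (fderiv (b n) x) * norm (h x - F n x)"
        by (rule norm_outer_le)
      also have "\<dots> \<le> C / q n * (9 * C0 * M * q n)"
        using b(4) u C q(1)[of n] by (intro mult_mono) auto
      finally show "norm (outer (h x - F n x) (fderiv (b n) x)) \<le> C / q n * (9 * C0 * M * q n)" .
    qed (use F(2) u b in auto)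
    moreover have "2 * (C0 * M) + M + C / q n * (9 * C0 * M * q n) \<le> K1"
      using q(1)[of n] MC0 by (simp add: K1_def algebra_simps)
    ultimately show ?thesis by simp
  next
    case False
    have ev: "\<forall>\<^sub>F z in nhds x. F n z = S n z"
      using b_far[OF False] by eventually_elim (simp add: S_def)
    show ?thesis
      using fderiv_transform[OF F(1) ev] eventually_nhds_x_imp_x[OF ev] F(2)[of n x] K1 C0 M(1) q(1)[of n]
      by simp
  qed
  have S_step: "norm (S (Suc n) x - S n x) \<le> 16 * C0 * M * q n" if x: "d x < q n" for n x
  proof -
    obtain y where y: "y \<in> Y" "dist x y < q n" using near[OF x] by blast
    have F_near: "norm (F m x - F m y) \<le> C0 * M * q n" for m
      using y(2) M(1) C0 by (intro order_trans[OF F_lip] mult_left_mono) auto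
    have "M * q m \<le> C0 * M * q n" if "n \<le> m" for m
      using MC0 q(1)[of m] q_mono[OF that] M(1) C0 by (intro mult_mono) auto
    then have hF: "norm (h y - F m y) \<le> C0 * M * q n" if "n \<le> m" for m
      using F(3)[OF y(1), of m] that by (meson less_imp_le order_trans)
    have S1: "norm (S n x - F n x) \<le> 9 * C0 * M * q n"
      using S_bounds[of x n] x q(1)[of n] by simp
    have S2: "norm (S (Suc n) x - F (Suc n) x) \<le> 9 * C0 * M * q n / 4"
      using S_bounds[of x "Suc n"] x q(2)[of n] by simp
    have "norm (S (Suc n) x - S n x) = norm ((S (Suc n) x - F (Suc n) x) + (F (Suc n) x - F (Suc n) y)
        + (F n y - F n x) + (h y - F n y) - (h y - F (Suc n) y) - (S n x - F n x))"
      by simp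
    also have "\<dots> \<le> norm (S (Suc n) x - F (Suc n) x) + norm (F (Suc n) x - F (Suc n) y)
        + norm (F n y - F n x) + norm (h y - F n y) + norm (h y - F (Suc n) y) + norm (S n x - F n x)"
      by (rule norm_six_terms_le)
    finally have "norm (S (Suc n) x - S n x) \<le> norm (S (Suc n) x - F (Suc n) x) + norm (F (Suc n) x - F (Suc n) y)
        + norm (F n y - F n x) + norm (h y - F n y) + norm (h y - F (Suc n) y) + norm (S n x - F n x)" .
    moreover have "norm (F n y - F n x) = norm (F n x - F n y)" by (rule norm_minus_commute)
    moreover have "C0 * M * q n \<ge> 0" using C0 M(1) q(1)[of n] by simp
    ultimately show ?thesis
      using S1 S2 F_near[of n] F_near[of "Suc n"] hF[of n] hF[of "Suc n"] by simp
  qed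
  have "q n / 2 > 0" for n using q(1)[of n] by simp
  then have "\<forall>n. \<exists>a. is_bump C {x. d x < q n / 2} (q n / 2) a" using bumps by blast
  from choice[OF this] obtain a where a_bump: "\<forall>n. is_bump C {x. d x < q n / 2} (q n / 2) (a n)" ..
  have a: "C1_at (a n) x" "0 \<le> a n x" "a n x \<le> 1" "norm (fderiv (a n) x) \<le> 2 * C / q n" for n x
    using a_bump by (auto simp: is_bump_def mult.commute)
  have a_far: "\<forall>\<^sub>F z in nhds x. a n z = 0" if "\<not> d x < q n" for n x
  proof (rule is_bump_eventually_0[OF a_bump[THEN spec]])
    show "\<not> (\<exists>s\<in>{x. d x < q n / 2}. dist x s < q n / 2)"
    proof
      assume "\<exists>s\<in>{x. d x < q n / 2}. dist x s < q n / 2"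
      then obtain s where "d s < q n / 2" "dist x s < q n / 2" by blast
      then show False using infdist_triangle[of x Y s] that unfolding d_def by linarith
    qed
  qed
  have a_1: "a n x = 1" if "d x < q n / 2" for n x
    using eventually_nhds_x_imp_x[OF is_bump_eventually_1[OF a_bump[THEN spec]]] that by simp
  define H where "H = rec_nat (S 0) (\<lambda>n Hn x. Hn x + a n x *\<^sub>R (S (Suc n) x - Hn x))"
  have H_0: "H 0 = S 0" and H_Suc: "H (Suc n) = (\<lambda>x. H n x + a n x *\<^sub>R (S (Suc n) x - H n x))" for n
    by (simp_all add: H_def)
  define K where "K = (9 * C0 + 59 * C0 * C) * M"
  have inv: "(\<forall>x. C1_at (H n) x \<and> norm (fderiv (H n) x) \<le> K) \<and> (\<forall>x. d x < 2 * q n \<longrightarrow> H n x = S n x)" for n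
  proof (induction n)
    case 0
    have "S 0 = F 0" by (auto simp: S_def b_def)
    moreover have "C0 * M \<le> K"
      using C0 C M(1) unfolding K_def by (intro mult_right_mono) (auto simp: add_increasing2)
    ultimately show ?case using F(1)[of 0] F(2)[of 0] by (auto simp: H_0 intro: order_trans)
  next
    case (Suc n)
    have HC1: "C1_at (H n) x" for x using Suc by blast
    have HD: "fderiv (H (Suc n)) x = fderiv (H n) x + (a n x *\<^sub>R (fderiv (S (Suc n)) x - fderiv (H n) x)
        + outer (S (Suc n) x - H n x) (fderiv (a n) x))" for x
      unfolding H_Suc by (intro fderiv_interpolation HC1 S_C1 a)
    have "norm (fderiv (H (Suc n)) x) \<le> K" for x
    proof (cases "d x < q n")
      case True
      then have "x \<in> {x. d x < 2 * q n}" using q(1)[of n] by simp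
      with open_d(1) have "\<forall>\<^sub>F z in nhds x. z \<in> {x. d x < 2 * q n}"
        by (rule eventually_nhds_in_open)
      then have ev: "\<forall>\<^sub>F z in nhds x. S n z = H n z"
        by (rule eventually_mono) (use Suc in simp)
      have eq: "fderiv (H n) x = fderiv (S n) x" "H n x = S n x"
        using fderiv_transform[OF S_C1 ev] eventually_nhds_x_imp_x[OF ev] by simp_all
      have "norm (fderiv (H (Suc n)) x) \<le> 2 * K1 + K1 + 2 * C / q n * (16 * C0 * M * q n)"
        unfolding HD eq
      proof (rule norm_interpolation_le)
        show "norm (fderiv (S n) x) \<le> K1" using S_bounds[of x n] True q(1)[of n] by simp
        show "norm (fderiv (S (Suc n)) x) \<le> K1" using S_bounds[of x "Suc n"] True q(2)[of n] by simp
        have "norm (outer (S (Suc n) x - S n x) (fderiv (a n) x)) \<le> norm (fderiv (a n) x) * norm (S (Suc n) x - S n x)"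
          by (rule norm_outer_le)
        also have "\<dots> \<le> 2 * C / q n * (16 * C0 * M * q n)"
          using a(4) S_step[OF True] C q(1)[of n] by (intro mult_mono) auto
        finally show "norm (outer (S (Suc n) x - S n x) (fderiv (a n) x)) \<le> 2 * C / q n * (16 * C0 * M * q n)" .
      qed (use a in auto)
      also have "\<dots> = K" using q(1)[of n] by (simp add: K1_def K_def algebra_simps)
      finally show ?thesis .
    next
      case False
      have ev: "\<forall>\<^sub>F z in nhds x. H n z = H (Suc n) z"
        using a_far[OF False] by eventually_elim (simp add: H_Suc)
      show ?thesis using fderiv_transform[OF HC1 ev] Suc by simp
    qed
    moreover have "C1_at (H (Suc n)) x" for x
      unfolding H_Suc by (intro fderiv_interpolation HC1 S_C1 a)
    moreover have "H (Suc n) x = S (Suc n) x" if "d x < 2 * q (Suc n)" for x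
      using a_1[of x n] that q(2)[of n] by (simp add: H_Suc)
    ultimately show ?case by blast
  qed
  have stable_Y: "\<exists>N. \<forall>\<^sub>F z in nhds y. \<forall>n\<ge>N. H n z = h z" if y: "y \<in> Y" for y
  proof -
    obtain e where e: "e > 0" "ball y e \<subseteq> U" using openU YU y openE by blast
    obtain N0 where N0: "q N0 < e / 10" using q_small[of "e / 10"] e(1) by auto
    define N where "N = Suc N0"
    have N: "10 * q N < e" using N0 q_mono[of N0 N] by (simp add: N_def)
    have Sh: "S n z = h z" if z: "dist y z < e / 2" and n: "N \<le> n" for n z
    proof -
      have "ball z (5 * q n) \<subseteq> ball y e"
      proof
        fix w assume "w \<in> ball z (5 * q n)"
        then show "w \<in> ball y e"
          using dist_triangle[of y w z] z N q_mono[OF n] by simp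
      qed
      then have "z \<in> V n" using e(2) by (auto simp: V_def)
      then show ?thesis using b_1[of z n] n by (simp add: S_def N_def)
    qed
    have "y \<in> ball y (e / 2) \<inter> {x. d x < 2 * q N}" using e(1) y q(1)[of N] by (simp add: d_def)
    then have "\<forall>\<^sub>F z in nhds y. z \<in> ball y (e / 2) \<inter> {x. d x < 2 * q N}"
      by (intro eventually_nhds_in_open open_Int open_ball open_d)
    then have "\<forall>\<^sub>F z in nhds y. \<forall>n\<ge>N. H n z = h z"
    proof eventually_elim
      case (elim z)
      show ?case
      proof (intro allI impI)
        fix n assume "N \<le> n"
        then show "H n z = h z"
        proof (induction n rule: dec_induct)
          case base
          show ?case using inv[of N] Sh[of z N] elim by simp
        next
          case (step n)
          then show ?case using Sh[of z "Suc n"] elim by (simp add: H_Suc)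
        qed
      qed
    qed
    then show ?thesis by blast
  qed
  have stable: "\<exists>N. \<forall>\<^sub>F z in nhds x. \<forall>n\<ge>N. H n z = H N z" for x
  proof (cases "x \<in> Y")
    case True
    then obtain N where "\<forall>\<^sub>F z in nhds x. \<forall>n\<ge>N. H n z = h z" using stable_Y by blast
    then have "\<forall>\<^sub>F z in nhds x. \<forall>n\<ge>N. H n z = H N z" by eventually_elim auto
    then show ?thesis by blast
  next
    case False
    then have dx: "d x > 0" unfolding d_def using infdist_pos_not_in_closed[OF Y(2) Y0] by simp
    obtain N where N: "q N < d x / 2" using q_small[of "d x / 2"] dx by auto
    have "\<forall>\<^sub>F z in nhds x. z \<in> {z. d x / 2 < d z}"
      using dx by (intro eventually_nhds_in_open open_d) simp
    then have "\<forall>\<^sub>F z in nhds x. \<forall>n\<ge>N. H n z = H N z"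
    proof eventually_elim
      case (elim z)
      show ?case
      proof (intro allI impI)
        fix n assume "N \<le> n"
        then show "H n z = H N z"
        proof (induction n rule: dec_induct)
          case (step n)
          have "\<not> d z < q n" using elim N q_mono[OF step(1)] by simp
          then have "a n z = 0" by (rule eventually_nhds_x_imp_x[OF a_far])
          then show ?case using step by (simp add: H_Suc)
        qed simp
      qed
    qed
    then show ?thesis by blast
  qed
  define G where "G x = lim (\<lambda>n. H n x)" for x
  have G: "\<exists>N. \<forall>\<^sub>F z in nhds x. H N z = G z" for x
    unfolding G_def by (rule locally_stabilizing_limit[OF stable])
  show thesis
  proof
    fix x
    obtain N where N: "\<forall>\<^sub>F z in nhds x. H N z = G z" using G by blast
    have C1: "C1_at (H N) x" using inv by blast
    show "C1_at G x" by (rule C1_at_transform[OF C1 N])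
    show "norm (fderiv G x) \<le> (9 * C0 + 59 * C0 * C) * M"
      using fderiv_transform[OF C1 N] inv[of N] by (simp add: K_def)
  next
    fix y assume "y \<in> Y"
    then obtain N where "\<forall>\<^sub>F z in nhds y. \<forall>n\<ge>N. H n z = h z" using stable_Y by blast
    then have "\<forall>n\<ge>N. H n y = h y" by (rule eventually_nhds_x_imp_x)
    then have "(\<lambda>n. H n y) \<longlonglongrightarrow> h y"
      by (intro tendsto_eventually eventually_sequentiallyI[of N]) blast
    then show "G y = h y" by (simp add: G_def limI)
  qed
qed

section \<open>Extension\<close>

lemma C1_deriv_on_cong:
  assumes "C1_deriv_on Y f f'" "\<And>y. y \<in> Y \<Longrightarrow> f y = g y"
  shows "C1_deriv_on Y g f'"
proof -
  have "norm (g y - g x - f' x (y - x)) = norm (f y - f x - f' x (y - x))" if "x \<in> Y" "y \<in> Y" for x y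
    using that by (simp add: assms(2)[symmetric])
  with assms(1) show ?thesis unfolding C1_deriv_on_def by (simp cong: ball_cong)
qed

lemma C1_sum_of_geometric_series:
  fixes H :: "nat \<Rightarrow> 'a::real_normed_vector \<Rightarrow> 'b::banach"
  assumes H: "\<And>n x. C1_at (H n) x" and B: "\<And>n x. norm (fderiv (H n) x) \<le> B / 2 ^ n"
    and sum0: "(\<lambda>n. H n x0) sums s"
  obtains G where "\<And>x. (\<lambda>n. H n x) sums G x" "\<And>x. C1_at G x" "\<And>x. norm (fderiv G x) \<le> 2 * B"
proof -
  define D where "D x = (\<Sum>n. fderiv (H n) x)" for x
  have geo: "(\<lambda>n. B / 2 ^ n) sums (2 * B)"
    using sums_mult[OF geometric_sums[of "1/2 :: real"], of B] by (simp add: power_one_over field_simps)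
  have unif: "uniform_limit UNIV (\<lambda>n x. \<Sum>i<n. fderiv (H i) x) D sequentially"
    unfolding D_def using B geo by (intro Weierstrass_m_test) (auto simp: sums_iff)
  have "\<exists>G. \<forall>x\<in>UNIV. (\<lambda>n. H n x) sums G x \<and> (G has_derivative blinfun_apply (D x)) (at x within UNIV)"
  proof (rule has_derivative_series)
    show "(H n has_derivative blinfun_apply (fderiv (H n) x)) (at x within UNIV)" for n x
      using C1_at_has_derivative[OF H] by simp
    fix e :: real assume "e > 0"
    with unif have "\<forall>\<^sub>F n in sequentially. \<forall>x\<in>UNIV. dist (\<Sum>i<n. fderiv (H i) x) (D x) < e"
      by (simp add: uniform_limit_iff)
    then show "\<forall>\<^sub>F n in sequentially. \<forall>x\<in>UNIV. \<forall>v.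
        norm ((\<Sum>i<n. blinfun_apply (fderiv (H i) x) v) - blinfun_apply (D x) v) \<le> e * norm v"
    proof eventually_elim
      case (elim n)
      show ?case
      proof (intro ballI allI)
        fix x v
        have "norm ((\<Sum>i<n. fderiv (H i) x) - D x) \<le> e" using elim by (simp add: dist_norm less_imp_le)
        then have "norm (((\<Sum>i<n. fderiv (H i) x) - D x) v) \<le> e * norm v"
          using norm_blinfun mult_right_mono[OF _ norm_ge_zero[of v]] order_trans by blast
        then show "norm ((\<Sum>i<n. blinfun_apply (fderiv (H i) x) v) - blinfun_apply (D x) v) \<le> e * norm v"
          by (simp add: blinfun.bilinear_simps)
      qed
    qed
  qed (use sum0 in auto)
  then obtain G where G: "\<And>x. (\<lambda>n. H n x) sums G x" "\<And>x. (G has_derivative blinfun_apply (D x)) (at x)"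
    by auto
  have "continuous_on UNIV D"
    using H by (intro uniform_limit_theorem[OF _ unif] always_eventually allI continuous_on_sum)
      (auto simp: C1_at_def continuous_on_eq_continuous_at)
  then have D: "isCont D x" for x by (simp add: continuous_on_eq_continuous_at)
  have DB: "norm (D x) \<le> 2 * B" for x
    using norm_suminf_le[of "\<lambda>n. fderiv (H n) x" "\<lambda>n. B / 2 ^ n"] B geo by (simp add: D_def sums_iff)
  show thesis
  proof
    show "(\<lambda>n. H n x) sums G x" for x by (rule G)
    show "C1_at G x" for x by (rule C1_atI[OF always_eventually D]) (rule allI G)+
    show "norm (fderiv G x) \<le> 2 * B" for x unfolding fderiv_eqI[OF G(2)] by (rule DB)
  qed
qed

text \<open>
  The successive remainders \<open>g n\<close>, paired with their derivatives along \<open>Y\<close>, are obtained by dependent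
  choice. The summands \<open>g n - g (n + 1)\<close> are defined on the whole space and telescope on \<open>Y\<close>. Every
  remainder after the first is made to vanish at \<open>0\<close>, which turns the bounds \<open>L / 2 ^ n\<close> on
  derivatives into convergence of \<open>g n\<close> to \<open>0\<close> at each point of \<open>Y\<close>.
\<close>

lemma lipschitz_C1_extension:
  fixes Y :: "'a::real_normed_vector set" and f :: "'a \<Rightarrow> 'b::banach"
  assumes approx: "C1_approximable TYPE('a) TYPE('b) C0"
    and bumps: "\<And>(S::'a set) \<delta>. \<delta> > 0 \<Longrightarrow> \<exists>\<beta>. is_bump C S \<delta> \<beta>" and C: "C > 0"
    and Y: "subspace Y" "closed Y"
    and l: "l \<ge> 0" and ext: "\<And>T. bounded_linear_on Y T \<Longrightarrow>
      \<exists>T'::'a \<Rightarrow>\<^sub>L 'b. (\<forall>y\<in>Y. blinfun_apply T' y = T y) \<and> norm T' \<le> l * onorm_on Y T"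
    and f: "C1_deriv_on Y f f'" and L: "L > 0" "\<And>y v. y \<in> Y \<Longrightarrow> v \<in> Y \<Longrightarrow> norm (f' y v) \<le> L * norm v"
  obtains G where "\<And>x. C1_at G x" "\<And>y. y \<in> Y \<Longrightarrow> G y = f y"
    "\<And>x. norm (fderiv G x) \<le> 2 * ((9 * C0 + 59 * C0 * C) * (l + 1)) * L"
proof -
  define K where "K = (9 * C0 + 59 * C0 * C) * (l + 1)"
  have Y0: "0 \<in> Y" by (rule subspace_0[OF Y(1)])
  define ok where "ok n s \<longleftrightarrow> (n = 0 \<longrightarrow> fst s = f) \<and> C1_deriv_on Y (fst s) (snd s) \<and>
      (\<forall>y\<in>Y. \<forall>v\<in>Y. norm (snd s y v) \<le> L / 2 ^ n * norm v)" for n :: nat and s :: "('a \<Rightarrow> 'b) \<times> ('a \<Rightarrow> 'a \<Rightarrow> 'b)"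
  define link where "link n s t \<longleftrightarrow> (\<forall>x. C1_at (\<lambda>x. fst s x - fst t x) x \<and>
      norm (fderiv (\<lambda>x. fst s x - fst t x) x) \<le> K * L / 2 ^ n) \<and> fst t 0 = 0"
    for n :: nat and s t :: "('a \<Rightarrow> 'b) \<times> ('a \<Rightarrow> 'a \<Rightarrow> 'b)"
  have "\<exists>s. \<forall>n. ok n (s n) \<and> link n (s n) (s (Suc n))"
  proof (rule dependent_nat_choice)
    show "\<exists>s. ok 0 s" using f L(2) by (intro exI[of _ "(f, f')"]) (simp add: ok_def)
  next
    fix s n assume s: "ok n s"
    define Ln where "Ln = L / 2 ^ n"
    have Ln: "Ln > 0" using L(1) by (simp add: Ln_def)
    then have Ln2: "Ln / 2 > 0" by simp
    have sD: "C1_deriv_on Y (fst s) (snd s)" using s by (simp add: ok_def)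
    obtain h0 where h0: "\<And>x. C1_at h0 x"
      "\<And>y v. y \<in> Y \<Longrightarrow> v \<in> Y \<Longrightarrow> norm (snd s y v - fderiv h0 y v) \<le> Ln / 2 * norm v"
      "\<And>M y. 0 \<le> M \<Longrightarrow> \<forall>y\<in>Y. \<forall>v\<in>Y. norm (snd s y v) \<le> M * norm v \<Longrightarrow> y \<in> Y \<Longrightarrow>
        norm (fderiv h0 y) \<le> l * M + Ln / 2"
      by (rule C1_approximation_with_derivative[OF approx bumps C Y l ext sD Ln2]) (assumption | rule that)+
    \<comment> \<open>a constant is added so that the next remainder vanishes at \<open>0\<close>\<close>
    define h where "h x = h0 x + (fst s 0 - h0 0)" for x
    have h: "C1_at h x" "fderiv h x = fderiv h0 x" for x
      unfolding h_def[abs_def] using h0(1) by (simp_all add: C1_at_add fderiv_add)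
    have M: "(l + 1) * Ln > 0" using l Ln by simp
    have hM: "norm (fderiv h y) < (l + 1) * Ln" if "y \<in> Y" for y
      using h0(3)[of Ln y] s Ln that by (simp add: ok_def Ln_def[symmetric] h(2) algebra_simps)
    obtain H where H: "\<And>x. C1_at H x" "\<And>y. y \<in> Y \<Longrightarrow> H y = h y"
      "\<And>x. norm (fderiv H x) \<le> (9 * C0 + 59 * C0 * C) * ((l + 1) * Ln)"
      by (rule lipschitz_modification_off_subspace[of C0 C Y h, OF approx bumps C Y h(1) M hM]) (assumption | rule that)+
    define t where "t = (\<lambda>x. fst s x - H x, \<lambda>x v. snd s x v - fderiv h0 x v)"
    have eq: "(\<lambda>x. fst s x - fst t x) = H" by (simp add: t_def)
    have "C1_deriv_on Y (\<lambda>x. fst s x - h x) (\<lambda>x v. snd s x v - fderiv h x v)"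
      by (rule C1_deriv_on_diff[OF sD C1_deriv_on_fderiv[OF h(1)]])
    then have "C1_deriv_on Y (fst t) (snd t)"
      unfolding t_def fst_conv snd_conv h(2) by (rule C1_deriv_on_cong) (simp add: H(2))
    moreover have "norm (snd t y v) \<le> L / 2 ^ Suc n * norm v" if "y \<in> Y" "v \<in> Y" for y v
      using h0(2)[OF that] by (simp add: t_def Ln_def)
    ultimately have "ok (Suc n) t" by (simp add: ok_def)
    moreover have "link n s t"
      unfolding link_def eq using H(1,3) H(2)[OF Y0] by (simp add: K_def Ln_def t_def h_def mult.assoc)
    ultimately show "\<exists>t. ok (Suc n) t \<and> link n s t" by (intro exI[of _ t] conjI)
  qed
  then obtain s where "\<forall>n. ok n (s n) \<and> link n (s n) (s (Suc n))" ..
  then have s: "ok n (s n)" "link n (s n) (s (Suc n))" for n by simp_all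
  define g where "g n = fst (s n)" for n
  have g0: "g 0 = f" using s(1)[of 0] by (simp add: ok_def g_def)
  have tel: "(\<Sum>n<N. g n x - g (Suc n) x) = f x - g N x" for N x
    using sum_lessThan_telescope'[of "\<lambda>n. g n x" N] by (simp add: g0)
  have sums: "(\<lambda>n. g n y - g (Suc n) y) sums f y" if y: "y \<in> Y" for y
  proof -
    have "norm (g n y) \<le> L * norm y / 2 ^ n" if n: "n \<noteq> 0" for n
    proof -
      obtain m where m: "n = Suc m" using n not0_implies_Suc by blast
      have "(L / 2 ^ n)-lipschitz_on Y (g n)"
      proof (rule lipschitz_on_of_C1_deriv_on_bound[OF Y(1) subspace_imp_convex[OF Y(1)] subset_refl])
        show "C1_deriv_on Y (g n) (snd (s n))" using s(1)[of n] by (simp add: ok_def g_def)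
        show "norm (snd (s n) x v) \<le> L / 2 ^ n * norm v" if "x \<in> Y" "v \<in> Y" for x v
          using s(1)[of n] that by (simp add: ok_def)
      qed (use L(1) in simp)
      from lipschitz_onD[OF this y Y0] show ?thesis
        using s(2)[of m] by (simp add: link_def g_def m dist_norm)
    qed
    then have "\<forall>\<^sub>F n in sequentially. norm (g n y) \<le> L * norm y / 2 ^ n"
      by (intro eventually_sequentiallyI[of 1]) simp
    moreover have "(\<lambda>n. L * norm y / 2 ^ n) \<longlonglongrightarrow> 0"
    proof -
      have "(\<lambda>n. L * norm y * (1/2) ^ n) \<longlonglongrightarrow> L * norm y * 0"
        by (intro tendsto_mult tendsto_const LIMSEQ_power_zero) simp
      then show ?thesis by (simp add: power_one_over)
    qed
    ultimately have "(\<lambda>n. g n y) \<longlonglongrightarrow> 0" by (rule Lim_null_comparison)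
    from tendsto_diff[OF tendsto_const[of "f y"] this] show ?thesis
      by (simp add: sums_def tel)
  qed
  obtain G where G: "\<And>x. (\<lambda>n. g n x - g (Suc n) x) sums G x" "\<And>x. C1_at G x"
    "\<And>x. norm (fderiv G x) \<le> 2 * (K * L)"
  proof (rule C1_sum_of_geometric_series)
    show "C1_at (\<lambda>x. g n x - g (Suc n) x) x" "norm (fderiv (\<lambda>x. g n x - g (Suc n) x) x) \<le> K * L / 2 ^ n" for n x
      using s(2)[of n] by (simp_all add: link_def g_def)
    show "(\<lambda>n. g n 0 - g (Suc n) 0) sums f 0" by (rule sums[OF Y0])
  qed (rule that)
  show thesis
  proof
    show "C1_at G x" for x by (rule G)
    show "G y = f y" if "y \<in> Y" for y by (rule sums_unique2[OF G(1) sums[OF that]])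
    show "norm (fderiv G x) \<le> 2 * ((9 * C0 + 59 * C0 * C) * (l + 1)) * L" for x
      using G(3)[of x] by (simp add: K_def)
  qed
qed

theorem corollary4p7:
  fixes Y :: "'a::banach set"
  assumes "property_star TYPE('a) TYPE('b::banach)"
    and "subspace Y" and "closed Y"
    and "linear_extension_property Y TYPE('b)"
  shows "(\<forall>f::'a \<Rightarrow> 'b. C1_smooth_on Y f \<longrightarrow>
            (\<exists>F::'a \<Rightarrow> 'b. C1_smooth F \<and> (\<forall>y\<in>Y. F y = f y))) \<and>
         (\<exists>C::real. C \<ge> 1 \<and>
            (\<forall>f::'a \<Rightarrow> 'b. Lipschitz_on Y f \<and> C1_smooth_on Y f \<longrightarrow>
              (\<exists>F::'a \<Rightarrow> 'b. Lipschitz_on UNIV F \<and> C1_smooth F \<and>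
                (\<forall>y\<in>Y. F y = f y) \<and> Lip UNIV F \<le> C * Lip Y f)))"
proof -
  have const: "Lipschitz_on UNIV (\<lambda>_::'a. c) \<and> C1_smooth (\<lambda>_::'a. c) \<and> Lip UNIV (\<lambda>_::'a. c) \<le> 0" for c :: 'b
  proof -
    have 0: "0-lipschitz_on UNIV (\<lambda>_::'a. c)" by (rule lipschitz_onI) auto
    then show ?thesis using Lip_le[OF 0] by (auto simp: Lipschitz_on_def C1_smooth_iff_C1_at)
  qed
  have Lip_nonneg: "0 \<le> Lip Y f" if "Lipschitz_on Y f" for f :: "'a \<Rightarrow> 'b"
    by (rule lipschitz_on_nonneg[OF lipschitz_on_Lip[OF that]])
  show ?thesis
  proof (cases "\<exists>z::'b. z \<noteq> 0")
    case False
    then have eq: "a = b" for a b :: 'b by metis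
    show ?thesis
    proof (intro conjI allI impI exI[of _ "1::real"])
      fix f :: "'a \<Rightarrow> 'b"
      show "\<exists>F::'a \<Rightarrow> 'b. C1_smooth F \<and> (\<forall>y\<in>Y. F y = f y)"
        using const[of 0] eq by (intro exI[of _ "\<lambda>_. 0"]) blast
      assume "Lipschitz_on Y f \<and> C1_smooth_on Y f"
      then have "0 \<le> 1 * Lip Y f" using Lip_nonneg by simp
      then show "\<exists>F::'a \<Rightarrow> 'b. Lipschitz_on UNIV F \<and> C1_smooth F \<and> (\<forall>y\<in>Y. F y = f y) \<and> Lip UNIV F \<le> 1 * Lip Y f"
        using const[of 0] eq order_trans by (intro exI[of _ "\<lambda>_. 0"]) blast
    qed simp
  next
    case True
    then obtain z :: 'b where z: "z \<noteq> 0" by blast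
    obtain C0 where approx: "C1_approximable TYPE('a) TYPE('b) C0"
      using property_star_imp_C1_approximable[OF assms(1)] by blast
    then have C0: "C0 \<ge> 1" by (simp add: C1_approximable_def)
    obtain C where C: "C > 0" and bumps_all: "\<forall>(S::'a set) \<delta>. \<delta> > 0 \<longrightarrow> (\<exists>\<beta>. is_bump C S \<delta> \<beta>)"
      using bumps_exist[OF approx z] by auto
    have bumps: "\<exists>\<beta>. is_bump C S \<delta> \<beta>" if "\<delta> > 0" for S :: "'a set" and \<delta>
      using bumps_all that by simp
    obtain l :: real where l: "l \<ge> 1" and ext_all: "\<forall>T::'a \<Rightarrow> 'b. bounded_linear_on Y T \<longrightarrow>
        (\<exists>T'::'a \<Rightarrow>\<^sub>L 'b. (\<forall>y\<in>Y. blinfun_apply T' y = T y) \<and> norm T' \<le> l * onorm_on Y T)"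
      using assms(4) unfolding linear_extension_property_def by auto
    then have ext: "\<exists>T'::'a \<Rightarrow>\<^sub>L 'b. (\<forall>y\<in>Y. blinfun_apply T' y = T y) \<and> norm T' \<le> l * onorm_on Y T"
      if "bounded_linear_on Y T" for T using that by simp
    have l0: "l \<ge> 0" using l by simp
    define K where "K = 2 * ((9 * C0 + 59 * C0 * C) * (l + 1))"
    have K: "K \<ge> 1"
    proof -
      have "1 * 1 \<le> (9 * C0 + 59 * C0 * C) * (l + 1)"
        using C0 C l by (intro mult_mono add_increasing2) auto
      then show ?thesis by (simp add: K_def)
    qed
    show ?thesis
    proof (intro conjI allI impI exI[of _ K])
      fix f :: "'a \<Rightarrow> 'b" assume "C1_smooth_on Y f"
      then obtain f' where f': "C1_deriv_on Y f f'" using C1_smooth_on_iff[OF assms(2)] by blast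
      obtain h where h: "\<And>x. C1_at h x"
        "\<And>y v. y \<in> Y \<Longrightarrow> v \<in> Y \<Longrightarrow> norm (f' y v - fderiv h y v) \<le> 1 * norm v"
        by (rule C1_approximation_with_derivative[OF approx bumps C assms(2,3) l0 ext f' zero_less_one])
          (assumption | rule that)+
      have diff: "C1_deriv_on Y (\<lambda>x. f x - h x) (\<lambda>x v. f' x v - fderiv h x v)"
        by (rule C1_deriv_on_diff[OF f' C1_deriv_on_fderiv[OF h(1)]])
      obtain G where G: "\<And>x. C1_at G x" "\<And>y. y \<in> Y \<Longrightarrow> G y = f y - h y"
        by (rule lipschitz_C1_extension[OF approx bumps C assms(2,3) l0 ext diff zero_less_one h(2)])
          (assumption | rule that)+
      show "\<exists>F::'a \<Rightarrow> 'b. C1_smooth F \<and> (\<forall>y\<in>Y. F y = f y)"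
        using h(1) G by (intro exI[of _ "\<lambda>x. h x + G x"]) (simp add: C1_smooth_iff_C1_at C1_at_add)
    next
      fix f :: "'a \<Rightarrow> 'b" assume f: "Lipschitz_on Y f \<and> C1_smooth_on Y f"
      then obtain f' where f': "C1_deriv_on Y f f'" using C1_smooth_on_iff[OF assms(2)] by blast
      have L: "(Lip Y f)-lipschitz_on Y f" using f by (simp add: lipschitz_on_Lip)
      show "\<exists>F::'a \<Rightarrow> 'b. Lipschitz_on UNIV F \<and> C1_smooth F \<and> (\<forall>y\<in>Y. F y = f y) \<and> Lip UNIV F \<le> K * Lip Y f"
      \<comment> \<open>for a constant \<open>f\<close> the tolerances \<open>L / 2 ^ n\<close> would be zero\<close>
      proof (cases "Lip Y f = 0")
        case True
        then have "f y = f 0" if "y \<in> Y" for y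
          using lipschitz_onD[OF L that subspace_0[OF assms(2)]] by simp
        then show ?thesis using const[of "f 0"] True by (intro exI[of _ "\<lambda>_. f 0"]) simp
      next
        case False
        then have Lpos: "Lip Y f > 0" using Lip_nonneg f by (simp add: less_le)
        have f'_le: "norm (f' y v) \<le> Lip Y f * norm v" if yv: "y \<in> Y" "v \<in> Y" for y v
        proof (rule norm_derivative_le_of_lipschitz[where f = f and x = y])
          have yt: "y + t *\<^sub>R v \<in> Y" for t
            using yv by (intro subspace_add subspace_scale assms(2))
          show "f' y (c *\<^sub>R v) = c *\<^sub>R f' y v" for c
            using C1_deriv_on_linear[OF f' yv(1)] yv(2) by (simp add: bounded_linear_on_def)
          show "norm (f (y + t *\<^sub>R v) - f y) \<le> Lip Y f * norm (t *\<^sub>R v)" for t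
            using lipschitz_onD[OF L yt yv(1), of t] by (simp add: dist_norm)
          fix e :: real assume e: "e > 0"
          obtain d where "d > 0" "\<And>z. z \<in> Y \<Longrightarrow> norm (z - y) < d \<Longrightarrow> norm (f z - f y - f' y (z - y)) \<le> e * norm (z - y)"
            by (rule C1_deriv_on_approx[OF f' yv(1) e]) (rule that)
          then show "\<exists>\<delta>>0. \<forall>t. norm (t *\<^sub>R v) < \<delta> \<longrightarrow>
              norm (f (y + t *\<^sub>R v) - f y - f' y (t *\<^sub>R v)) \<le> e * norm (t *\<^sub>R v)"
            using yt by (metis add_diff_cancel_left')
        qed
        obtain G where G: "\<And>x. C1_at G x" "\<And>y. y \<in> Y \<Longrightarrow> G y = f y"
          "\<And>x. norm (fderiv G x) \<le> K * Lip Y f"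
          by (rule lipschitz_C1_extension[OF approx bumps C assms(2,3) l0 ext f' Lpos f'_le, folded K_def])
            (assumption | rule that)+
        have "G differentiable (at x)" for x
          using C1_at_has_derivative[OF G(1)] by (auto simp: differentiable_def)
        then have lip: "(K * Lip Y f)-lipschitz_on UNIV G"
          using G(3) K Lpos by (intro lipschitz_on_of_norm_fderiv_le) auto
        show ?thesis
          using G(1,2) lip Lip_le[OF lip] by (intro exI[of _ G]) (auto simp: C1_smooth_iff_C1_at Lipschitz_on_def)
      qed
    qed (rule K)
  qed
qed

end
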